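(* Let $G$ be a segment. \begin{enumerate} \item If $G\in\mathcal{C}_=$, then $Ls(G)\in\{2,4\}$ and $Rs(G)\in\{-2,-4\}$. \item If $G\in\mathcal{C}_-$, then $Ls(G)\in\{1,3\}$ and $Rs(G)\in\{-1,-3,-5\}$. Moreover, if $|L(G)|$ is odd, then $Ls(G)=3$. \item If $G\in\mathcal{C}_+$, then $Ls(G)\in\{1,3,5\}$ and $Rs(G)\in\{-1,-3\}$. Moreover, if $|L(G)|$ is even, then $Rs(G)=-3$. \end{enumerate}
   Context: **Game.** A position is a finite directed graph $G=(L\cup R,A)$ whose vertex set $V(G)=L\cup R$ is partitioned into $L=L(G)$ and $R=R(G)$. For $S\subseteq V(G)$, $G\setminus S$ is the subgraph induced on $V(G)\setminus S$. $\mathrm{Succ}(G,x)$ (resp. $\mathrm{Pred}(G,x)$) is the set of vertices reachable from $x$ (resp. that can reach $x$) by a directed path, including $x$. Left and Right alternate; Left chooses $x\in L$ and removes $\mathrm{Succ}(G,x)$, Right chooses $y\in R$ and removes $\mathrm{Pred}(G,y)$; a player's score is the number of vertices he removed. **Relevant graphs.** $\mathrm{Forc}(G)=\{x\in L:\mathrm{Succ}(G,x)\subseteq L\}\cup\{y\in R:\mathrm{Pred}(G,y)\subseteq R\}$ is the set of forced vertices; $G$ is relevant if $\mathrm{Forc}(G)=\emptyset$. Let $\mathcal{S}$ be the class of relevant graphs. On relevant graphs, forced vertices created by a move are immediately given to the player who moved: for $x\in L$, $\mathrm{Rmv}(G,x)=\mathrm{Succ}(G,x)\cup\mathrm{Forc}(G\setminus\mathrm{Succ}(G,x))$;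 for $y\in R$, $\mathrm{Rmv}(G,y)=\mathrm{Pred}(G,y)\cup\mathrm{Forc}(G\setminus\mathrm{Pred}(G,y))$; and $G_u=G\setminus\mathrm{Rmv}(G,u)$, again in $\mathcal{S}$. **Relative scores.** $Ls(G)$ (resp. $Rs(G)$) is Left's score minus Right's score under optimal play when Left (resp. Right) starts: $Ls(\emptyset)=Rs(\emptyset)=0$ and, for nonempty $G\in\mathcal{S}$, $Ls(G)=\max_{x\in L}\{|\mathrm{Rmv}(G,x)|+Rs(G_x)\}$, $Rs(G)=\min_{y\in R}\{-|\mathrm{Rmv}(G,y)|+Ls(G_y)\}$. **Segments.** A segment is a directed graph whose vertex set is a finite set of at least two consecutive integers, with $L$ the even integers and $R$ the odd integers of this set, and whose arcs are exactly the $(2i,2i+1)$ and $(2i,2i-1)$ having both ends in the vertex set. Segments are relevant. For a segment $G$: $G\in\mathcal{C}_=$ means $|V(G)|$ is even; $G\in\mathcal{C}_+$ means $|V(G)|$ is odd and $|L|-|R|=1$; $G\in\mathcal{C}_-$ means $|V(G)|$ is odd and $|L|-|R|=-1$. *)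

theory Defs
  imports "Graph_Theory.Digraph_Component"
begin

record ('a, 'b) position =
  dig :: "('a, 'b) pre_digraph"
  left :: "'a set"

abbreviation vertices :: "('a, 'b) position \<Rightarrow> 'a set" where
  "vertices G \<equiv> verts (dig G)"

definition right :: "('a, 'b) position \<Rightarrow> 'a set" where
  "right G = vertices G - left G"

text \<open>
  An arc is determined by its ends, hence no parallel arcs. Loops are allowed; they do not
  affect reachability.
\<close>

definition is_position :: "('a, 'b) position \<Rightarrow> bool" where
  "is_position G \<longleftrightarrow>
     fin_digraph (dig G) \<and> nomulti_digraph (dig G) \<and> left G \<subseteq> vertices G"

definition remove :: "('a, 'b) position \<Rightarrow> 'a set \<Rightarrow> ('a, 'b) position" where
  "remove G S = \<lparr> dig = dig G \<restriction> (vertices G - S), left = left G - S \<rparr>"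

definition Succ :: "('a, 'b) position \<Rightarrow> 'a \<Rightarrow> 'a set" where
  "Succ G x = {v. x \<rightarrow>\<^sup>*\<^bsub>dig G\<^esub> v}"

definition Pred :: "('a, 'b) position \<Rightarrow> 'a \<Rightarrow> 'a set" where
  "Pred G y = {u. u \<rightarrow>\<^sup>*\<^bsub>dig G\<^esub> y}"

definition Forc :: "('a, 'b) position \<Rightarrow> 'a set" where
  "Forc G = {x \<in> left G. Succ G x \<subseteq> left G} \<union> {y \<in> right G. Pred G y \<subseteq> right G}"

definition relevant :: "('a, 'b) position \<Rightarrow> bool" where
  "relevant G \<longleftrightarrow> is_position G \<and> Forc G = {}"

text \<open>The else branch is meant for \<open>u \<in> right G\<close>; a move at any other \<open>u\<close> is never considered.\<close>

definition Rmv :: "('a, 'b) position \<Rightarrow> 'a \<Rightarrow> 'a set" where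
  "Rmv G u =
     (if u \<in> left G then Succ G u \<union> Forc (remove G (Succ G u))
      else Pred G u \<union> Forc (remove G (Pred G u)))"

definition move :: "('a, 'b) position \<Rightarrow> 'a \<Rightarrow> ('a, 'b) position" where
  "move G u = remove G (Rmv G u)"

lemma vertices_remove [simp]: "vertices (remove G S) = vertices G - S"
  and left_remove [simp]: "left (remove G S) = left G - S"
  and right_remove [simp]: "right (remove G S) = right G - S"
  by (auto simp: remove_def right_def)

lemma remove_remove: "remove (remove G S) T = remove G (S \<union> T)"
  by (auto simp: remove_def induce_subgraph_def)

lemma is_position_remove:
  assumes "is_position G"
  shows "is_position (remove G S)"
proof -
  interpret fin_digraph "dig G" using assms by (simp add: is_position_def)
  interpret nomulti_digraph "dig G" using assms by (simp add: is_position_def)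
  have "fin_digraph (dig G \<restriction> T)" if "T \<subseteq> vertices G" for T
    using that finite_subset[OF that] by unfold_locales auto
  moreover have "nomulti_digraph (dig G \<restriction> T)" if "T \<subseteq> vertices G" for T
    using that no_multi_arcs by unfold_locales (auto simp: arc_to_ends_def)
  ultimately show ?thesis using assms
    by (auto simp: is_position_def remove_def)
qed

lemma relevant_remove_Forc:
  assumes "is_position H"
  shows "relevant (remove H (Forc H))"
proof -
  interpret fin_digraph "dig H" using assms by (simp add: is_position_def)
  let ?K = "remove H (Forc H)"
  have pos: "is_position ?K" by (rule is_position_remove[OF assms])
  then interpret K: fin_digraph "dig ?K" by (simp add: is_position_def)
  have path: "x \<rightarrow>\<^sup>*\<^bsub>dig ?K\<^esub> z"
    if "x \<rightarrow>\<^sup>*\<^bsub>dig H\<^esub> z" "z \<rightarrow>\<^sup>*\<^bsub>dig H\<^esub> y" "x \<in> left H" "y \<in> right H" for x y z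
    using that(1,2)
  proof (induct rule: reachable_induct)
    case base
    then show ?case using that(3,4)
      by (auto simp: reachable_def Forc_def Succ_def right_def)
  next
    case (step z w)
    have "z \<rightarrow>\<^sup>*\<^bsub>dig H\<^esub> y" using step by (meson adj_reachable_trans)
    moreover have "x \<rightarrow>\<^sup>*\<^bsub>dig H\<^esub> w" using step by (meson reachable_adj_trans)
    ultimately have nf: "z \<notin> Forc H" "w \<notin> Forc H" and v: "z \<in> vertices H" "w \<in> vertices H"
      using step that(3,4) by (auto simp: Forc_def Succ_def Pred_def right_def
          elim: reachable_in_vertsE)
    have "z \<rightarrow>\<^bsub>dig ?K\<^esub> w" using step(2) nf v
      by (auto simp: remove_def arcs_ends_conv)
    then show ?case using step(3) \<open>z \<rightarrow>\<^sup>*\<^bsub>dig H\<^esub> y\<close> by (meson K.reachable_adj_trans)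
  qed
  have "False" if "x \<in> Forc ?K" for x
  proof (cases "x \<in> left H")
    case True
    then have x: "x \<notin> Forc H" "Succ ?K x \<subseteq> left H"
      using that by (auto simp: Forc_def right_def)
    then obtain y where y: "x \<rightarrow>\<^sup>*\<^bsub>dig H\<^esub> y" "y \<notin> left H"
      using True by (auto simp: Forc_def Succ_def)
    then have "y \<in> right H" "y \<in> vertices H" by (auto simp: right_def elim: reachable_in_vertsE)
    then have "x \<rightarrow>\<^sup>*\<^bsub>dig ?K\<^esub> y" using path y True by auto
    then show ?thesis using x y by (auto simp: Succ_def)
  next
    case False
    then have x: "x \<notin> Forc H" "x \<in> right H" "Pred ?K x \<subseteq> right H"
      using that by (auto simp: Forc_def)
    then obtain u where u: "u \<rightarrow>\<^sup>*\<^bsub>dig H\<^esub> x" "u \<notin> right H"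
      by (auto simp: Forc_def Pred_def)
    then have "u \<in> left H" by (auto simp: right_def elim: reachable_in_vertsE)
    moreover have "x \<rightarrow>\<^sup>*\<^bsub>dig H\<^esub> x" using x(2) by (auto simp: right_def)
    ultimately have "u \<rightarrow>\<^sup>*\<^bsub>dig ?K\<^esub> x" using path u x by auto
    then show ?thesis using x u by (auto simp: Pred_def)
  qed
  with pos show ?thesis by (auto simp: relevant_def)
qed

lemma relevant_move: "is_position G \<Longrightarrow> relevant (move G u)"
  unfolding move_def Rmv_def
  by (auto simp flip: remove_remove intro: relevant_remove_Forc is_position_remove)

lemma relevant_both_sides:
  assumes "relevant G" "vertices G \<noteq> {}"
  shows "left G \<noteq> {}" "right G \<noteq> {}"
  using assms
  by (auto simp: relevant_def Forc_def right_def is_position_def Succ_def Pred_def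
      elim!: reachable_in_vertsE)

lemma card_move:
  assumes "relevant G" "u \<in> vertices G"
  shows "card (vertices (move G u)) < card (vertices G)"
proof -
  have "u \<in> Rmv G u" using assms(2) by (auto simp: Rmv_def Succ_def Pred_def reachable_def)
  moreover have "finite (vertices G)"
    using assms(1) by (simp add: relevant_def is_position_def fin_digraph.finite_verts)
  ultimately show ?thesis using assms(2)
    by (auto simp: move_def intro!: psubset_card_mono)
qed

text \<open>
  The value 0 is meant for the empty position. Positions that are not relevant also get
  it, only to make the functions total: by \<open>relevant_move\<close> the recursion never
  leaves the relevant positions, and by \<open>relevant_both_sides\<close> the maximum and the
  minimum range over nonempty sets.
\<close>

function Ls Rs :: "('a, 'b) position \<Rightarrow> int" where
  "Ls G = (if relevant G \<and> vertices G \<noteq> {}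
           then MAX x\<in>left G. int (card (Rmv G x)) + Rs (move G x) else 0)"
| "Rs G = (if relevant G \<and> vertices G \<noteq> {}
           then MIN y\<in>right G. - int (card (Rmv G y)) + Ls (move G y) else 0)"
  by pat_completeness auto
termination
  by (relation "measure (case_sum (\<lambda>G. card (vertices G)) (\<lambda>G. card (vertices G)))")
    (auto intro!: card_move simp: relevant_def is_position_def right_def)

declare Ls.simps [simp del] Rs.simps [simp del]

definition segment_on :: "int set \<Rightarrow> (int, int \<times> int) position" where
  "segment_on V =
     \<lparr> dig = with_proj
         \<lparr> pverts = V,
           parcs = {(u, v). u \<in> V \<and> v \<in> V \<and>
                      (\<exists>i. (u, v) = (2 * i, 2 * i + 1) \<or> (u, v) = (2 * i, 2 * i - 1))} \<rparr>,
       left = {k \<in> V. even k} \<rparr>"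

definition is_segment :: "(int, int \<times> int) position \<Rightarrow> bool" where
  "is_segment G \<longleftrightarrow> (\<exists>a b. a < b \<and> G = segment_on {a..b})"

definition C_eq :: "(int, int \<times> int) position set" where
  "C_eq = {G. is_segment G \<and> even (card (vertices G))}"

definition C_plus :: "(int, int \<times> int) position set" where
  "C_plus = {G. is_segment G \<and> odd (card (vertices G)) \<and>
                int (card (left G)) - int (card (right G)) = 1}"

definition C_minus :: "(int, int \<times> int) position set" where
  "C_minus = {G. is_segment G \<and> odd (card (vertices G)) \<and>
                 int (card (left G)) - int (card (right G)) = -1}"

lemma segment_relevant:
  assumes "is_segment G"
  shows "relevant G"
proof -
  obtain a b where ab: "a < b" and G: "G = segment_on {a..b}"
    using assms by (auto simp: is_segment_def)
  have fin: "finite {(u, v). u \<in> {a..b} \<and> v \<in> {a..b} \<and> P u v}" for P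
    by (rule finite_subset[of _ "{a..b} \<times> {a..b}"]) auto
  interpret wf_digraph "dig G"
    by unfold_locales (auto simp: G segment_on_def)
  have pos: "is_position G"
    unfolding is_position_def fin_digraph_def fin_digraph_axioms_def
      nomulti_digraph_def nomulti_digraph_axioms_def
    using wf_digraph fin
    by (auto simp: G segment_on_def arc_to_ends_def)
  have adj: "\<exists>w. odd w \<and> w \<in> {a..b} \<and> x \<rightarrow>\<^bsub>dig G\<^esub> w" if "x \<in> left G" for x
  proof -
    have x: "even x" "x \<in> {a..b}" using that by (auto simp: G segment_on_def)
    then obtain i where i: "x = 2 * i" by (elim evenE)
    show ?thesis
    proof (cases "x < b")
      case True
      then show ?thesis using i x by (intro exI[of _ "x + 1"]) (auto simp: G segment_on_def)
    next
      case False
      then show ?thesis using i x ab by (intro exI[of _ "x - 1"]) (auto simp: G segment_on_def)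
    qed
  qed
  have adj': "\<exists>w. w \<in> left G \<and> w \<rightarrow>\<^bsub>dig G\<^esub> y" if "y \<in> right G" for y
  proof -
    have y: "odd y" "y \<in> {a..b}" using that by (auto simp: G segment_on_def right_def)
    then obtain i where i: "y = 2 * i + 1" by (elim oddE)
    show ?thesis
    proof (cases "a < y")
      case True
      then show ?thesis using i y by (intro exI[of _ "y - 1"]) (auto simp: G segment_on_def)
    next
      case False
      then have "y + 1 \<in> {a..b}" using y ab by auto
      then show ?thesis using i y
        by (intro exI[of _ "y + 1"]) (auto simp: G segment_on_def intro!: exI[of _ "i + 1"])
    qed
  qed
  have "\<not> Succ G x \<subseteq> left G" if x: "x \<in> left G" for x
  proof -
    obtain w where "odd w" "x \<rightarrow>\<^bsub>dig G\<^esub> w" using adj[OF x] by blast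
    then have "w \<in> Succ G x" "w \<notin> left G"
      by (simp_all add: Succ_def reachable_adjI) (simp add: G segment_on_def)
    then show ?thesis by blast
  qed
  moreover have "\<not> Pred G y \<subseteq> right G" if y: "y \<in> right G" for y
  proof -
    obtain w where "w \<in> left G" "w \<rightarrow>\<^bsub>dig G\<^esub> y" using adj'[OF y] by blast
    then have "w \<in> Pred G y" "w \<notin> right G"
      by (simp_all add: Pred_def reachable_adjI right_def)
    then show ?thesis by blast
  qed
  ultimately have "Forc G = {}" by (simp add: Forc_def)
  with pos show ?thesis by (simp add: relevant_def)
qed

end

theory Submission
  imports Defs "HOL-Library.Multiset"
begin

text \<open>
  A move in a segment removes a vertex with its neighbours and splits the segment in two, so
  the positions that arise are sums of segments. Since a move is never a disadvantage, Milnor's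
  inequalities hold for such sums, and a segment together with its colour-reversed copy can be
  dropped from a sum. Hence the answers to consider are those that create a pair of opposite
  segments: for instance, Left cuts an odd segment with right ends into two equal halves for a
  gain of 3, and against any other cut Right cuts the longer part so that one piece is opposite to
  the shorter part. Bounds for a few families of sums of two segments, proved by simultaneous
  inductions, give the bounds for single segments; the exact sets of values follow by parity.
\<close>

section \<open>The game on sets of integers\<close>

text \<open>Two encodings of a position serve different needs. A set of integers allows arbitrary
  vertices to be deleted, which the comparison behind the absence of zugzwang requires; a multiset
  of components forgets where the pieces lie, so that cancellation becomes computation. The obstacle
  in the estimates is that a cancelling reply does not always exist: a cut of \<open>Ev c\<close>
  can cancel \<open>Od p a\<close> only if c >= a + 2, and a cut of \<open>Od p a\<close> can cancel
  \<open>Ev c\<close> only if a >= c + 1. Pairs of equal or consecutive parameters therefore get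
  bounds of their own. Such pairs are also what a cut near the middle leaves, so upper bounds for
  them yield the lower bounds for single segments. The upper bounds 3, 4, 5 are 3 + e, where 3 is
  the gain of a middle cut and e = 0, 1, 2 is the loss that the opponent may still suffer on the
  pieces.\<close>

definition nb :: "int \<Rightarrow> int set" where
  "nb x = {x - 1, x, x + 1}"

definition live :: "int set \<Rightarrow> int set" where
  "live V = {x \<in> V. x - 1 \<in> V \<or> x + 1 \<in> V}"

text \<open>Players are Booleans: Left is \<open>True\<close>, so player \<open>p\<close> owns the vertices \<open>x\<close> with \<open>even x = p\<close>.\<close>

definition movable :: "bool \<Rightarrow> int set \<Rightarrow> int set" where
  "movable p V = {x \<in> live V. even x = p}"

definition score :: "bool \<Rightarrow> int set \<Rightarrow> int" where
  "score p V = (\<Sum>v\<in>V. if even v = p then 1 else - 1)"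

lemma finite_nb [simp]: "finite (nb x)"
  by (simp add: nb_def)

lemma self_in_nb [simp]: "x \<in> nb x"
  by (simp add: nb_def)

lemma finite_movable [simp]: "finite V \<Longrightarrow> finite (movable p V)"
  by (simp add: movable_def live_def)

text \<open>Neighbours have different owners, so a vertex with a neighbour gives a move to both
  players. Hence the game ends for both at the same moment, and passing never arises in
  \<open>sval\<close>.\<close>

lemma movable_empty_iff: "movable p V = {} \<longleftrightarrow> live V = {}"
proof
  assume m: "movable p V = {}"
  show "live V = {}"
  proof (rule ccontr)
    assume "live V \<noteq> {}"
    then obtain x where x: "x \<in> live V" by blast
    then obtain y where y: "y \<in> V" "y = x - 1 \<or> y = x + 1" by (auto simp: live_def)
    then have "y \<in> live V" using x by (auto simp: live_def)
    moreover have "even x \<noteq> even y" using y by auto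
    ultimately show False using x m by (auto simp: movable_def)
  qed
qed (auto simp: movable_def)

lemma movable_subset: "movable p V \<subseteq> V"
  by (auto simp: movable_def live_def)

text \<open>
  The score of the player to move minus that of the opponent. Instead of being handed to the
  mover at once, isolated vertices stay on the board and are counted for their owner at the end;
  this makes the value meaningful for every finite set of integers.
\<close>

function sval :: "bool \<Rightarrow> int set \<Rightarrow> int" where
  "sval p V =
     (if finite V \<and> movable p V \<noteq> {}
      then MAX x\<in>movable p V. int (card (nb x \<inter> V)) - sval (\<not> p) (V - nb x)
      else score p V)"
  by pat_completeness auto
termination
proof (relation "measure (\<lambda>(p, V). card V)")
  fix p V x
  assume "finite V \<and> movable p V \<noteq> {}" "x \<in> movable p V"
  then have "V - nb x \<subset> V" "finite V" using movable_subset[of p V] self_in_nb[of x] by blast+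
  then show "((\<not> p, V - nb x), p, V) \<in> measure (\<lambda>(p, V). card V)"
    by (simp add: psubset_card_mono)
qed simp

declare sval.simps [simp del]

lemma sval_terminal: "live V = {} \<Longrightarrow> sval p V = score p V"
  by (simp add: sval.simps movable_empty_iff)

lemma sval_ge:
  assumes "finite V" "x \<in> movable p V"
  shows "int (card (nb x \<inter> V)) - sval (\<not> p) (V - nb x) \<le> sval p V"
  using assms by (subst (2) sval.simps) (auto intro!: Max_ge)

lemma sval_attained:
  assumes "finite V" "live V \<noteq> {}"
  obtains x where "x \<in> movable p V"
    "sval p V = int (card (nb x \<inter> V)) - sval (\<not> p) (V - nb x)"
proof -
  let ?f = "\<lambda>x. int (card (nb x \<inter> V)) - sval (\<not> p) (V - nb x)"
  have "sval p V = Max (?f ` movable p V)" "movable p V \<noteq> {}"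
    using assms by (simp_all add: sval.simps[of p V] movable_empty_iff)
  moreover from this have "Max (?f ` movable p V) \<in> ?f ` movable p V"
    using assms by (intro Max_in) auto
  ultimately show thesis using that by auto
qed

lemma score_neg: "score (\<not> p) V = - score p V"
  unfolding score_def sum_negf[symmetric] by (rule sum.cong) auto

lemma score_Diff:
  assumes "finite V" "S \<subseteq> V"
  shows "score p V = score p S + score p (V - S)"
  unfolding score_def by (subst sum.subset_diff[OF assms(2,1)]) simp

lemma score_le_card: "score p S \<le> int (card S)"
proof (cases "finite S")
  case True
  have "score p S \<le> (\<Sum>v\<in>S. 1)" unfolding score_def by (rule sum_mono) auto
  then show ?thesis by simp
qed (simp add: score_def)

text \<open>No move touches an isolated vertex: were it in \<open>nb y\<close>, then
  \<open>y\<close> would be its neighbour. So the recursions on \<open>V\<close> and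
  \<open>V - {x}\<close> run in parallel and differ by a constant.\<close>

lemma sval_isolated:
  assumes "finite V" "x \<in> V" "x \<notin> live V"
  shows "sval p V = (if even x = p then 1 else - 1) + sval p (V - {x})"
  using assms
proof (induction "card V" arbitrary: V p rule: less_induct)
  case less
  let ?W = "V - {x}" and ?c = "if even x = p then 1 else - 1 :: int"
  have liveW: "live ?W = live V" using less.prems by (auto simp: live_def)
  then have mv: "movable p ?W = movable p V" by (simp add: movable_def)
  show ?case
  proof (cases "live V = {}")
    case True
    have "score p V = score p {x} + score p ?W"
      using less.prems by (intro score_Diff) auto
    then show ?thesis using True liveW by (simp add: sval_terminal score_def)
  next
    case False
    have eq: "int (card (nb y \<inter> V)) - sval (\<not> p) (V - nb y)
        = ?c + (int (card (nb y \<inter> ?W)) - sval (\<not> p) (?W - nb y))"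
      if y: "y \<in> movable p V" for y
    proof -
      have yV: "y \<in> V" "y \<in> live V" using y movable_subset by (auto simp: movable_def)
      then have xn: "x \<notin> nb y" using less.prems by (auto simp: live_def nb_def)
      have "card (V - nb y) < card V"
        using yV less.prems self_in_nb[of y] by (intro psubset_card_mono) blast+
      then have "sval (\<not> p) (V - nb y) = - ?c + sval (\<not> p) (V - nb y - {x})"
        using less.hyps[of "V - nb y" "\<not> p"] less.prems xn by (auto simp: live_def)
      moreover have "nb y \<inter> ?W = nb y \<inter> V" "?W - nb y = V - nb y - {x}" using xn by auto
      ultimately show ?thesis by simp
    qed
    show ?thesis
    proof (rule antisym)
      obtain y where y: "y \<in> movable p V"
        "sval p V = int (card (nb y \<inter> V)) - sval (\<not> p) (V - nb y)"
        using sval_attained[OF less.prems(1) False] .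
      then show "sval p V \<le> ?c + sval p ?W"
        using eq[OF y(1)] sval_ge[of ?W y p] mv less.prems by simp
    next
      obtain y where y: "y \<in> movable p ?W"
        "sval p ?W = int (card (nb y \<inter> ?W)) - sval (\<not> p) (?W - nb y)"
        using sval_attained[of ?W p] False less.prems(1) liveW by auto
      then show "?c + sval p ?W \<le> sval p V"
        using eq[of y] sval_ge[of V y p] mv less.prems by simp
    qed
  qed
qed

lemma sval_isolated_set:
  assumes "finite V" "I \<subseteq> V - live V" "\<And>x. x \<in> I \<Longrightarrow> even x = q"
  shows "sval p V = (if q = p then int (card I) else - int (card I)) + sval p (V - I)"
proof -
  have "finite I" using assms finite_subset by blast
  then show ?thesis using assms(2,3)
  proof (induction I)
    case (insert x I)
    have "x \<notin> live (V - I)" using insert.prems by (auto simp: live_def)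
    then have "sval p (V - I) = (if even x = p then 1 else - 1) + sval p (V - I - {x})"
      using insert assms(1) by (intro sval_isolated) auto
    moreover have "V - I - {x} = V - insert x I" by auto
    moreover have "sval p V = (if q = p then int (card I) else - int (card I)) + sval p (V - I)"
      using insert by auto
    moreover have "even x = q" using insert by auto
    ultimately show ?case using insert(1,2) by auto
  qed simp
qed

text \<open>For Left these are the sets closed under successors, for Right the sets closed under
  predecessors; the property survives the deletion of any further vertices.\<close>

definition closed_for :: "bool \<Rightarrow> int set \<Rightarrow> int set \<Rightarrow> bool" where
  "closed_for p V S \<longleftrightarrow> S \<subseteq> V \<and> (\<forall>x\<in>S. even x = p \<longrightarrow> nb x \<inter> V \<subseteq> S)"

lemma closed_for_Diff: "closed_for p V S \<Longrightarrow> closed_for p (V - T) (S - T)"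
  by (auto simp: closed_for_def)

lemma closed_for_nb: "even x = p \<Longrightarrow> closed_for p V (nb x \<inter> V)"
  by (auto simp: closed_for_def nb_def)

lemma closed_for_Un: "closed_for p V S \<Longrightarrow> closed_for p V T \<Longrightarrow> closed_for p V (S \<union> T)"
  by (auto simp: closed_for_def)

text \<open>
  Giving player \<open>p\<close> for free a set that \<open>p\<close> could remove bit by bit never hurts \<open>p\<close>: on the smaller
  board \<open>p\<close> copies the moves made on the larger one, playing anywhere when the copied vertex
  is already gone.
\<close>

lemma sval_closed:
  assumes "finite V" "closed_for p V S"
  shows "sval p V \<le> int (card S) + sval p (V - S)"
    and "sval (\<not> p) (V - S) \<le> int (card S) + sval (\<not> p) V"
proof -
  have "sval p V \<le> int (card S) + sval p (V - S) \<and>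
    sval (\<not> p) (V - S) \<le> int (card S) + sval (\<not> p) V"
    using assms
  proof (induction "card V" arbitrary: V S rule: less_induct)
    case less
    let ?U = "V - S"
    have SV: "S \<subseteq> V" and finS: "finite S" and fin: "finite V" "finite ?U"
      using less.prems finite_subset by (auto simp: closed_for_def)
    have IH: "sval p (V - nb x) \<le> int (card T) + sval p (V - nb x - T)"
      "sval (\<not> p) (V - nb x - T) \<le> int (card T) + sval (\<not> p) (V - nb x)"
      if "x \<in> V" "closed_for p (V - nb x) T" for x T
    proof -
      have "card (V - nb x) < card V"
        using that fin self_in_nb[of x] by (intro psubset_card_mono) blast+
      then show "sval p (V - nb x) \<le> int (card T) + sval p (V - nb x - T)"
        "sval (\<not> p) (V - nb x - T) \<le> int (card T) + sval (\<not> p) (V - nb x)"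
        using less.hyps[of "V - nb x" T] that fin by auto
    qed
    have opp_in: "x \<in> S" if "y \<in> S" "even y = p" "x \<in> nb y" "x \<in> V" for x y
      using that less.prems(2) by (auto simp: closed_for_def)
    show ?case
    proof (cases "live V = {}")
      case True
      then have "live ?U = {}" by (auto simp: live_def)
      then show ?thesis
        using True score_Diff[OF fin(1) SV, of p] score_Diff[OF fin(1) SV, of "\<not> p"]
          score_le_card[of p S] score_le_card[of "\<not> p" S]
        by (simp add: sval_terminal score_neg)
    next
      case V: False
      have "sval p V \<le> int (card S) + sval p ?U"
      proof -
        obtain x where x: "x \<in> movable p V"
          and eq: "sval p V = int (card (nb x \<inter> V)) - sval (\<not> p) (V - nb x)"
          using sval_attained[OF fin(1) V] .
        have xV: "x \<in> V" and xp: "even x = p" using x by (auto simp: movable_def live_def)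
        \<comment> \<open>Once \<open>p\<close> has moved at \<open>x\<close>, the rest of
          \<open>T\<close> is a free gift on a smaller board, to which the second inequality of the
          induction applies.\<close>
        have bound: "sval p V \<le> int (card T) - sval (\<not> p) (V - T)"
          if T: "closed_for p V T" "nb x \<inter> V \<subseteq> T" for T
        proof -
          have "T \<subseteq> V" using T by (simp add: closed_for_def)
          then have "T = (nb x \<inter> V) \<union> (T - nb x)" "V - nb x - (T - nb x) = V - T" "finite T"
            using T fin finite_subset by auto
          moreover from this have "card T = card (nb x \<inter> V) + card (T - nb x)"
            by (metis Diff_disjoint Int_Diff card_Un_disjoint finite_Diff finite_Int finite_nb
                inf.commute Diff_Int_distrib inf_bot_right inf_assoc)
          ultimately show ?thesis
            using IH(2)[OF xV closed_for_Diff[OF T(1), of "nb x"]] eq by simp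
        qed
        show ?thesis
        proof (cases "movable p ?U = {}")
          \<comment> \<open>Nobody can move in \<open>?U\<close>, so its value is the same up to
            sign whoever starts. If \<open>x\<close> lies outside \<open>S\<close>, it counts 1 for
            \<open>p\<close> whether taken or left.\<close>
          case True
          then have U: "live ?U = {}" by (simp add: movable_empty_iff)
          let ?T = "S \<union> (nb x \<inter> V)"
          have sub: "nb x \<inter> ?U \<subseteq> {x}"
          proof
            fix y assume y: "y \<in> nb x \<inter> ?U"
            then have "x \<notin> S" using opp_in[of x y] xp by auto
            then show "y \<in> {x}" using U y xV by (auto simp: live_def nb_def)
          qed
          have b: "sval p V \<le> int (card ?T) - sval (\<not> p) (V - ?T)"
            using less.prems closed_for_nb[OF xp] by (intro bound closed_for_Un) auto
          have neg: "sval (\<not> p) ?U = - sval p ?U"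
            using U by (simp add: sval_terminal score_neg)
          show ?thesis
          proof (cases "x \<in> S")
            case True
            then have "?T = S" using opp_in[of x] xp by auto
            then show ?thesis using b neg by simp
          next
            case False
            then have T: "?T = insert x S" using sub xV SV by auto
            then have "V - ?T = ?U - {x}" by auto
            moreover have "sval (\<not> p) ?U = - 1 + sval (\<not> p) (?U - {x})"
              using sval_isolated[of ?U x "\<not> p"] fin U xV False xp by auto
            ultimately show ?thesis using b neg T False finS by simp
          qed
        next
          case False
          then obtain z where z: "z \<in> movable p ?U" "x \<in> movable p ?U \<Longrightarrow> z = x" by blast
          have zp: "even z = p" "z \<in> ?U" using z movable_subset by (auto simp: movable_def)
          let ?T = "S \<union> (nb z \<inter> V)"
          have cT: "closed_for p V ?T"
            using less.prems closed_for_nb[OF zp(1)] by (intro closed_for_Un) auto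
          have "?T = S \<union> (nb z \<inter> ?U)" by (auto simp: SV[THEN subsetD])
          moreover have "S \<inter> (nb z \<inter> ?U) = {}" by auto
          ultimately have cardT: "card ?T = card S + card (nb z \<inter> ?U)"
            using finS by (simp add: card_Un_disjoint)
          have VT: "V - ?T = ?U - nb z" by auto
          have g: "int (card (nb z \<inter> ?U)) - sval (\<not> p) (?U - nb z) \<le> sval p ?U"
            by (rule sval_ge[OF fin(2) z(1)])
          show ?thesis
          proof (cases "x \<in> S \<or> x = z")
            case True
            then have "nb x \<inter> V \<subseteq> ?T" using opp_in[of x] xp by auto
            then show ?thesis using bound[OF cT] VT cardT g by simp
          next
            \<comment> \<open>Here \<open>x\<close> survives the gift but has lost all its
              neighbours. It counts 1 for \<open>p\<close> on the smaller board anyway, so adding it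
              to the gift changes nothing.\<close>
            case x': False
            then have iso: "x \<notin> live ?U" using z xp xV by (auto simp: movable_def)
            have xz: "x \<notin> nb z" using x' xp zp by (auto simp: nb_def)
            have sub: "nb x \<inter> V \<subseteq> insert x ?T"
              using iso x' xV by (auto simp: live_def nb_def)
            have "closed_for p V (insert x ?T)"
              using cT sub xV unfolding closed_for_def by blast
            then have "sval p V \<le> int (card (insert x ?T)) - sval (\<not> p) (V - insert x ?T)"
              using sub by (rule bound)
            moreover have "V - insert x ?T = ?U - nb z - {x}" by auto
            moreover have "sval (\<not> p) (?U - nb z) = - 1 + sval (\<not> p) (?U - nb z - {x})"
              using sval_isolated[of "?U - nb z" x "\<not> p"] fin xV x' xz xp iso
              by (auto simp: live_def)
            moreover have "card (insert x ?T) = card ?T + 1"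
              using x' xz finS by simp
            ultimately show ?thesis using cardT g by simp
          qed
        qed
      qed
      moreover have "sval (\<not> p) ?U \<le> int (card S) + sval (\<not> p) V"
      proof (cases "live ?U = {}")
        case False
        then obtain y where y: "y \<in> movable (\<not> p) ?U"
          and eq: "sval (\<not> p) ?U = int (card (nb y \<inter> ?U)) - sval p (?U - nb y)"
          using sval_attained[OF fin(2), of "\<not> p"] by auto
        have yU: "y \<in> ?U" "even y \<noteq> p" "y \<in> movable (\<not> p) V"
          using y by (auto simp: movable_def live_def)
        \<comment> \<open>A neighbour of \<open>y\<close> in \<open>S\<close> would belong to
          \<open>p\<close> and force \<open>y\<close> into \<open>S\<close>; so the opponent's move
          takes the same vertices on both boards.\<close>
        have dis: "nb y \<inter> S = {}"
        proof (rule ccontr)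
          assume "nb y \<inter> S \<noteq> {}"
          then obtain u where u: "u \<in> nb y" "u \<in> S" by blast
          then have "u \<noteq> y" using yU by auto
          then have "even u = p" "y \<in> nb u" using u yU by (auto simp: nb_def)
          then show False using opp_in[of u y] u yU by auto
        qed
        then have "nb y \<inter> ?U = nb y \<inter> V" "S - nb y = S" "V - nb y - S = ?U - nb y" by auto
        then show ?thesis
          using eq IH(1)[of y S] closed_for_Diff[OF less.prems(2), of "nb y"] yU
            sval_ge[OF fin(1), of y "\<not> p"] by simp
      next
        \<comment> \<open>The opponent can no longer move on the smaller board, but on the larger
          one there is a move at some \<open>y\<close> in \<open>S\<close>. The vertices of
          \<open>?U\<close> that it takes were counted for \<open>p\<close>.\<close>
        case U: True
        obtain y where y: "y \<in> movable (\<not> p) V"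
          using V movable_empty_iff by blast
        then have yV: "y \<in> V" "even y \<noteq> p" by (auto simp: movable_def live_def)
        have yS: "y \<in> S"
        proof (rule ccontr)
          assume "y \<notin> S"
          obtain u where u: "u \<in> V" "u = y - 1 \<or> u = y + 1"
            using y by (auto simp: movable_def live_def)
          then have "even u = p" "y \<in> nb u" using yV by (auto simp: nb_def)
          then have "u \<notin> S" using opp_in[of u y] \<open>y \<notin> S\<close> yV by auto
          then show False using U u yV \<open>y \<notin> S\<close> by (auto simp: live_def)
        qed
        let ?I = "nb y \<inter> ?U"
        have ev: "even u = p" if "u \<in> ?I" for u
          using that yV yS by (auto simp: nb_def)
        have "sval p ?U = int (card ?I) + sval p (?U - ?I)"
          using sval_isolated_set[of ?U ?I p p] ev fin U by auto
        moreover have "?U - ?I = ?U - nb y" "V - nb y - (S - nb y) = ?U - nb y" by auto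
        moreover have "sval (\<not> p) ?U = - sval p ?U"
          using U by (simp add: sval_terminal score_neg)
        moreover have "card (S - nb y) \<le> card S" using finS by (simp add: card_mono)
        ultimately show ?thesis
          using sval_ge[OF fin(1) y] IH(1)[OF yV(1) closed_for_Diff[OF less.prems(2), of "nb y"]]
          by simp
      qed
      ultimately show ?thesis by blast
    qed
  qed
  then show "sval p V \<le> int (card S) + sval p (V - S)"
    "sval (\<not> p) (V - S) \<le> int (card S) + sval (\<not> p) V" by auto
qed

text \<open>The second summand, negated, is what \<open>p\<close> would get by passing. In
  \<open>sval_closed\<close> the gift is taken to be \<open>nb x \<inter> V\<close>, which is what a
  move of \<open>p\<close> at \<open>x\<close> removes; so moving is at least as good as
  passing.\<close>

lemma sval_no_zugzwang:
  assumes "finite V"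
  shows "0 \<le> sval p V + sval (\<not> p) V"
proof (cases "live V = {}")
  case True
  then show ?thesis by (simp add: sval_terminal score_neg)
next
  case False
  then obtain x where x: "x \<in> movable p V" using movable_empty_iff by blast
  then have "even x = p" by (simp add: movable_def)
  then have "sval (\<not> p) (V - nb x \<inter> V) \<le> int (card (nb x \<inter> V)) + sval (\<not> p) V"
    by (intro sval_closed assms closed_for_nb)
  moreover have "V - nb x \<inter> V = V - nb x" by auto
  ultimately show ?thesis using sval_ge[OF assms x] by simp
qed

section \<open>Sums of segments\<close>

text \<open>
  \<open>Ev n\<close> is a path with \<open>2 n\<close> vertices, \<open>Od q n\<close> a path with \<open>2 n + 1\<close> vertices whose end
  vertices belong to player \<open>q\<close>.
\<close>

datatype component = Ev nat | Od bool nat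

text \<open>The neighbours of the chosen vertex go with it, so a nonempty piece ends beside the cut
  in a vertex of the mover. A path with an even number of vertices has one end of each owner: hence
  one piece of each parity after a middle cut, and a single end move.\<close>

fun opts :: "bool \<Rightarrow> component \<Rightarrow> (int \<times> component multiset) set" where
  "opts p (Ev n) =
     {(2, {#Ev m#}) |m. Suc m = n} \<union> {(3, {#Od p a, Ev b#}) |a b. a + b + 2 = n}"
| "opts p (Od q n) =
     (if q = p then {(2, {#Od p m#}) |m. Suc m = n} \<union> {(3, {#Od p a, Od p b#}) |a b. a + b + 2 = n}
      else {(3, {#Ev a, Ev b#}) |a b. a + b + 1 = n})"

lemma opts_Ev_end: "(2, {#Ev n#}) \<in> opts p (Ev (Suc n))"
  and opts_Ev_mid: "a + b + 2 = n \<Longrightarrow> (3, {#Od p a, Ev b#}) \<in> opts p (Ev n)"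
  and opts_own_end: "(2, {#Od p n#}) \<in> opts p (Od p (Suc n))"
  and opts_own_mid: "a + b + 2 = n \<Longrightarrow> (3, {#Od p a, Od p b#}) \<in> opts p (Od p n)"
  and opts_opp: "q \<noteq> p \<Longrightarrow> a + b + 1 = n \<Longrightarrow> (3, {#Ev a, Ev b#}) \<in> opts p (Od q n)"
  by auto

fun csize :: "component \<Rightarrow> nat" where
  "csize (Ev n) = 2 * n"
| "csize (Od q n) = 2 * n + 1"

fun cscore :: "bool \<Rightarrow> component \<Rightarrow> int" where
  "cscore p (Ev n) = 0"
| "cscore p (Od q n) = (if q = p then 1 else - 1)"

definition moves :: "bool \<Rightarrow> component multiset \<Rightarrow> (int \<times> component multiset) set" where
  "moves p M = (\<Union>c\<in>set_mset M. (\<lambda>(k, D). (k, D + (M - {#c#}))) ` opts p c)"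

definition msize :: "component multiset \<Rightarrow> nat" where
  "msize M = \<Sum>\<^sub># (image_mset csize M)"

definition mscore :: "bool \<Rightarrow> component multiset \<Rightarrow> int" where
  "mscore p M = \<Sum>\<^sub># (image_mset (cscore p) M)"

lemma finite_opts [simp]: "finite (opts p c)"
proof -
  have *: "finite {(3 :: int, {#f a, g b#}) |a b. a + b + k = n}"
    for f g :: "nat \<Rightarrow> component" and k n :: nat
    by (rule finite_subset[of _ "(\<lambda>(a, b). (3, {#f a, g b#})) ` ({..n} \<times> {..n})"]) auto
  have "finite {(2 :: int, {#f m#}) |m. Suc m = n}" for f :: "nat \<Rightarrow> component" and n
    by (rule finite_subset[of _ "(\<lambda>m. (2, {#f m#})) ` {..n}"]) auto
  then show ?thesis using *[where k = 2] *[where k = 1] by (cases c) simp_all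
qed

lemma finite_moves [simp]: "finite (moves p M)"
  by (simp add: moves_def)

lemma opts_size: "(k, D) \<in> opts p c \<Longrightarrow> int (msize D) = int (csize c) - k \<and> 2 \<le> k"
  by (cases c) (auto simp: msize_def split: if_splits)

lemma msize_union [simp]: "msize (M + N) = msize M + msize N"
  and msize_add [simp]: "msize (add_mset c M) = csize c + msize M"
  and msize_empty [simp]: "msize {#} = 0"
  by (simp_all add: msize_def)

lemma mscore_union [simp]: "mscore p (M + N) = mscore p M + mscore p N"
  and mscore_add [simp]: "mscore p (add_mset c M) = cscore p c + mscore p M"
  and mscore_empty [simp]: "mscore p {#} = 0"
  by (simp_all add: mscore_def)

lemma mscore_neg: "mscore (\<not> p) M = - mscore p M"
proof (induction M)
  case (add c M)
  have "cscore (\<not> p) c = - cscore p c" by (cases c) auto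
  then show ?case using add by simp
qed simp

lemma movesE:
  assumes "m \<in> moves p M"
  obtains c K k D where "M = add_mset c K" "(k, D) \<in> opts p c" "m = (k, D + K)"
  using assms by (auto simp: moves_def dest!: multi_member_split)

lemma moves_size: "(k, N) \<in> moves p M \<Longrightarrow> int (msize N) = int (msize M) - k \<and> 2 \<le> k"
  by (auto elim!: movesE dest!: opts_size)

lemma moves_add: "(k, D) \<in> opts p c \<Longrightarrow> (k, D + M) \<in> moves p (add_mset c M)"
  unfolding moves_def by force

lemma moves_empty_iff: "moves p M = {} \<longleftrightarrow> (\<forall>c\<in>#M. csize c \<le> 1)"
proof -
  have ex: "\<exists>a b. a + b = k" for k :: nat
    by (rule exI[of _ 0]) simp
  have "opts p c = {} \<longleftrightarrow> csize c \<le> 1" for c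
  proof (cases c)
    case (Ev n)
    then show ?thesis by (cases n) (auto simp: ex)
  next
    case (Od q n)
    then show ?thesis by (cases n) (auto simp: ex)
  qed
  then show ?thesis by (auto simp: moves_def)
qed

function val :: "bool \<Rightarrow> component multiset \<Rightarrow> int" where
  "val p M = (if moves p M = {} then mscore p M
              else MAX m\<in>moves p M. fst m - val (\<not> p) (snd m))"
  by pat_completeness auto
termination
  by (relation "measure (\<lambda>(p, M). msize M)") (auto dest: moves_size)

declare val.simps [simp del]

lemma val_terminal: "moves p M = {} \<Longrightarrow> val p M = mscore p M"
  by (simp add: val.simps)

lemma val_ge_moves: "(k, N) \<in> moves p M \<Longrightarrow> k - val (\<not> p) N \<le> val p M"
  by (subst (2) val.simps) (force intro!: Max_ge)

lemma val_ge: "(k, D) \<in> opts p c \<Longrightarrow> k - val (\<not> p) (D + M) \<le> val p (add_mset c M)"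
  by (intro val_ge_moves moves_add)

lemma val_attained:
  assumes "moves p M \<noteq> {}"
  obtains k N where "(k, N) \<in> moves p M" "val p M = k - val (\<not> p) N"
proof -
  let ?f = "\<lambda>m. fst m - val (\<not> p) (snd m)"
  have "val p M = Max (?f ` moves p M)" using assms by (simp add: val.simps[of p M])
  moreover have "Max (?f ` moves p M) \<in> ?f ` moves p M" using assms by (intro Max_in) auto
  ultimately show thesis using that by fastforce
qed

section \<open>Realisation of components by intervals of integers\<close>

definition ivl :: "int \<Rightarrow> nat \<Rightarrow> int set" where
  "ivl a n = {a..<a + int n}"

text \<open>For even \<open>n\<close> the parity of \<open>a\<close> is dropped, because the two
  colourings of such a path are mirror images of each other.\<close>

definition comp_of :: "int \<Rightarrow> nat \<Rightarrow> component" where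
  "comp_of a n = (if even n then Ev (n div 2) else Od (even a) (n div 2))"

definition apart :: "int set \<Rightarrow> int set \<Rightarrow> bool" where
  "apart A B \<longleftrightarrow> (\<forall>u\<in>A. \<forall>v\<in>B. 2 \<le> \<bar>u - v\<bar>)"

inductive rep :: "int set \<Rightarrow> component multiset \<Rightarrow> bool" where
  rep_empty: "rep {} {#}"
| rep_add: "rep V M \<Longrightarrow> apart V (ivl a n) \<Longrightarrow> rep (V \<union> ivl a n) (add_mset (comp_of a n) M)"

lemma csize_comp_of [simp]: "csize (comp_of a n) = n"
  by (auto simp: comp_of_def)

lemma finite_ivl [simp]: "finite (ivl a n)"
  by (simp add: ivl_def)

lemma rep_finite: "rep V M \<Longrightarrow> finite V"
  by (induction rule: rep.induct) auto

text \<open>This carries facts proved for sets, such as \<open>sval_no_zugzwang\<close>, over to all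
  multisets.\<close>

lemma rep_exists: "\<exists>V. rep V M"
proof (induction M)
  case empty
  then show ?case using rep_empty by blast
next
  case (add c M)
  then obtain V where V: "rep V M" by blast
  obtain m where m: "\<And>v. v \<in> V \<Longrightarrow> v \<le> m"
    using bdd_above_finite[OF rep_finite[OF V]] by (auto simp: bdd_above_def)
  have ap: "apart V (ivl a n)" if "m + 2 \<le> a" for a n
    using that m by (force simp: apart_def ivl_def)
  have c: "\<exists>a\<ge>m + 2. \<exists>n. c = comp_of a n"
  proof (cases c)
    case (Ev n)
    then have "c = comp_of (m + 2) (2 * n)" by (simp add: comp_of_def)
    then show ?thesis by blast
  next
    case (Od q n)
    \<comment> \<open>The start keeps distance 2 from everything present and moves on by one more
      when its parity would give the ends to the wrong player.\<close>
    then have "c = comp_of (if even m = q then m + 2 else m + 3) (2 * n + 1)"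
      by (auto simp: comp_of_def)
    moreover have "m + 2 \<le> (if even m = q then m + 2 else m + 3)" by simp
    ultimately show ?thesis by blast
  qed
  then obtain a n where "m + 2 \<le> a" "c = comp_of a n" by blast
  then show ?case using rep_add[OF V ap] by blast
qed

lemma apart_sym: "apart A B \<Longrightarrow> apart B A"
  unfolding apart_def by (metis abs_minus_commute)

lemma apart_Un [simp]: "apart (A \<union> B) C \<longleftrightarrow> apart A C \<and> apart B C"
  by (auto simp: apart_def)

text \<open>\<open>rep\<close> adds intervals in some order; this allows the interval around a given
  vertex to be treated as the last one added.\<close>

lemma rep_pick:
  assumes "rep V M" "x \<in> V"
  obtains a n V' M' where "x \<in> ivl a n" "V = V' \<union> ivl a n" "apart V' (ivl a n)" "rep V' M'"
    "M = add_mset (comp_of a n) M'"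
proof -
  have "\<exists>a n V' M'. x \<in> ivl a n \<and> V = V' \<union> ivl a n \<and> apart V' (ivl a n) \<and> rep V' M' \<and>
      M = add_mset (comp_of a n) M'"
    using assms
  proof (induction rule: rep.induct)
    case (rep_add V M a n)
    show ?case
    proof (cases "x \<in> ivl a n")
      case True
      then show ?thesis using rep_add by blast
    next
      case False
      then obtain b m V' M' where *: "x \<in> ivl b m" "V = V' \<union> ivl b m" "apart V' (ivl b m)"
        "rep V' M'" "M = add_mset (comp_of b m) M'"
        using rep_add by blast
      have "apart (ivl a n) (ivl b m)" using rep_add(2) * by (simp add: apart_sym)
      then show ?thesis
        using * rep_add(2) rep.rep_add[of V' M' a n]
        by (intro exI[of _ b] exI[of _ m] exI[of _ "V' \<union> ivl a n"]
            exI[of _ "add_mset (comp_of a n) M'"]) (auto simp: add_mset_commute)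
    qed
  qed simp
  then show thesis using that by blast
qed

lemma rep_component:
  assumes "rep V M" "c \<in># M"
  obtains a n V' where "c = comp_of a n" "V = V' \<union> ivl a n" "apart V' (ivl a n)"
    "rep V' (M - {#c#})"
proof -
  have "\<exists>a n V'. c = comp_of a n \<and> V = V' \<union> ivl a n \<and> apart V' (ivl a n) \<and> rep V' (M - {#c#})"
    using assms
  proof (induction rule: rep.induct)
    case (rep_add V M a n)
    show ?case
    proof (cases "c = comp_of a n")
      case True
      then show ?thesis using rep_add by auto
    next
      case False
      then obtain b m V' where *: "c = comp_of b m" "V = V' \<union> ivl b m" "apart V' (ivl b m)"
        "rep V' (M - {#c#})"
        using rep_add by auto
      have "apart (ivl a n) (ivl b m)" using rep_add(2) * by (simp add: apart_sym)
      then show ?thesis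
        using * rep_add(2) rep.rep_add[of V' "M - {#c#}" a n] False
        by (intro exI[of _ b] exI[of _ m] exI[of _ "V' \<union> ivl a n"]) auto
    qed
  qed simp
  then show thesis using that by blast
qed

lemma score_Un: "finite A \<Longrightarrow> finite B \<Longrightarrow> A \<inter> B = {} \<Longrightarrow> score p (A \<union> B) = score p A + score p B"
  by (simp add: score_def sum.union_disjoint)

lemma apart_disjoint: "apart A B \<Longrightarrow> A \<inter> B = {}"
  by (force simp: apart_def)

lemma score_ivl: "score p (ivl a n) = cscore p (comp_of a n)"
proof (induction n)
  case 0
  then show ?case by (simp add: ivl_def comp_of_def score_def)
next
  case (Suc n)
  have "ivl a (Suc n) = insert (a + int n) (ivl a n)" "a + int n \<notin> ivl a n"
    by (auto simp: ivl_def)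
  then have "score p (ivl a (Suc n)) = (if even (a + int n) = p then 1 else - 1) + score p (ivl a n)"
    by (simp add: score_def)
  then show ?case using Suc by (auto simp: comp_of_def)
qed

lemma score_rep: "rep V M \<Longrightarrow> score p V = mscore p M"
proof (induction rule: rep.induct)
  case (rep_add V M a n)
  then show ?case
    using score_Un[of V "ivl a n" p] rep_finite[of V M] apart_disjoint[of V "ivl a n"]
    by (simp add: score_ivl)
qed (simp add: score_def)

lemma rep_live_empty: "rep V M \<Longrightarrow> live V = {} \<Longrightarrow> \<forall>c\<in>#M. csize c \<le> 1"
proof (induction rule: rep.induct)
  case (rep_add V M a n)
  have "live V = {}" using rep_add(4) by (auto simp: live_def)
  moreover have "n \<le> 1"
  proof (rule ccontr)
    assume "\<not> n \<le> 1"
    then have "a \<in> ivl a n" "a + 1 \<in> ivl a n" by (auto simp: ivl_def)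
    then have "a \<in> live (V \<union> ivl a n)" by (auto simp: live_def)
    then show False using rep_add(4) by simp
  qed
  ultimately show ?case using rep_add by simp
qed simp

lemma nb_apart:
  assumes "apart V (ivl a n)" "x \<in> ivl a n"
  shows "nb x \<inter> V = {}"
  using assms by (force simp: apart_def nb_def)

lemma rep_end_left:
  assumes "rep V M" "apart V (ivl a n)" "2 \<le> n"
  shows "card (nb a \<inter> (V \<union> ivl a n)) = 2"
    and "rep ((V \<union> ivl a n) - nb a) (add_mset (comp_of (a + 2) (n - 2)) M)"
proof -
  have nV: "nb a \<inter> V = {}" using assms by (intro nb_apart) (auto simp: ivl_def)
  have "nb a \<inter> ivl a n = {a, a + 1}" using assms(3) by (auto simp: nb_def ivl_def)
  then have "nb a \<inter> (V \<union> ivl a n) = {a, a + 1}" using nV by auto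
  then show "card (nb a \<inter> (V \<union> ivl a n)) = 2" by simp
  have "ivl a n - nb a = ivl (a + 2) (n - 2)" using assms(3) by (auto simp: nb_def ivl_def)
  then have "(V \<union> ivl a n) - nb a = V \<union> ivl (a + 2) (n - 2)" using nV by auto
  moreover have "apart V (ivl (a + 2) (n - 2))"
    using assms(2,3) by (auto simp: apart_def ivl_def)
  ultimately show "rep ((V \<union> ivl a n) - nb a) (add_mset (comp_of (a + 2) (n - 2)) M)"
    using rep_add[OF assms(1)] by simp
qed

lemma rep_end_right:
  assumes "rep V M" "apart V (ivl a n)" "2 \<le> n" "x = a + int n - 1"
  shows "card (nb x \<inter> (V \<union> ivl a n)) = 2"
    and "rep ((V \<union> ivl a n) - nb x) (add_mset (comp_of a (n - 2)) M)"
proof -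
  have nV: "nb x \<inter> V = {}" using assms by (intro nb_apart) (auto simp: ivl_def)
  have "nb x \<inter> ivl a n = {x - 1, x}" using assms(3,4) by (auto simp: nb_def ivl_def)
  then have "nb x \<inter> (V \<union> ivl a n) = {x - 1, x}" using nV by auto
  then show "card (nb x \<inter> (V \<union> ivl a n)) = 2" by simp
  have "ivl a n - nb x = ivl a (n - 2)" using assms(3,4) by (auto simp: nb_def ivl_def)
  then have "(V \<union> ivl a n) - nb x = V \<union> ivl a (n - 2)" using nV by auto
  moreover have "apart V (ivl a (n - 2))"
    using assms(2,3) by (auto simp: apart_def ivl_def)
  ultimately show "rep ((V \<union> ivl a n) - nb x) (add_mset (comp_of a (n - 2)) M)"
    using rep_add[OF assms(1)] by simp
qed

lemma rep_mid:
  assumes "rep V M" "apart V (ivl a n)" "i + j + 3 = n" "x = a + int i + 1"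
  shows "card (nb x \<inter> (V \<union> ivl a n)) = 3"
    and "rep ((V \<union> ivl a n) - nb x) ({#comp_of a i, comp_of (x + 2) j#} + M)"
proof -
  have nV: "nb x \<inter> V = {}" using assms by (intro nb_apart) (auto simp: ivl_def)
  have "nb x \<inter> ivl a n = nb x" using assms(3,4) by (auto simp: nb_def ivl_def)
  then have "nb x \<inter> (V \<union> ivl a n) = nb x" using nV by auto
  then show "card (nb x \<inter> (V \<union> ivl a n)) = 3" by (simp add: nb_def)
  have "ivl a n - nb x = ivl (x + 2) j \<union> ivl a i" using assms(3,4) by (auto simp: nb_def ivl_def)
  then have eq: "(V \<union> ivl a n) - nb x = V \<union> ivl (x + 2) j \<union> ivl a i" using nV by auto
  have "apart V (ivl a i)" "apart V (ivl (x + 2) j)" "apart (ivl (x + 2) j) (ivl a i)"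
    using assms(2,3,4) by (auto simp: apart_def ivl_def)
  then have "rep (V \<union> ivl (x + 2) j \<union> ivl a i)
      (add_mset (comp_of a i) (add_mset (comp_of (x + 2) j) M))"
    using assms(1) by (intro rep_add) auto
  then show "rep ((V \<union> ivl a n) - nb x) ({#comp_of a i, comp_of (x + 2) j#} + M)"
    using eq by simp
qed

text \<open>With its converse \<open>rep_moves\<close>, this is the bisimulation behind
  \<open>sval_rep\<close>. The chosen vertex is an end of its interval or cuts it into pieces of
  lengths \<open>i\<close> and \<open>j\<close>, whose parities decide the kind of option.\<close>

lemma rep_movable:
  assumes "rep V M" "x \<in> movable p V"
  obtains k N where "(k, N) \<in> moves p M" "k = int (card (nb x \<inter> V))" "rep (V - nb x) N"
proof -
  have x: "x \<in> V" "x - 1 \<in> V \<or> x + 1 \<in> V" "even x = p"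
    using assms(2) by (auto simp: movable_def live_def)
  obtain a n V' M' where *: "x \<in> ivl a n" "V = V' \<union> ivl a n" "apart V' (ivl a n)" "rep V' M'"
    and M: "M = add_mset (comp_of a n) M'"
    using rep_pick[OF assms(1) x(1)] .
  have "nb x \<inter> V' = {}" using * nb_apart by blast
  then have "x - 1 \<in> ivl a n \<or> x + 1 \<in> ivl a n" using x *(2) by (auto simp: nb_def)
  then have n: "2 \<le> n" using *(1) by (auto simp: ivl_def)
  have "\<exists>D. (int (card (nb x \<inter> V)), D) \<in> opts p (comp_of a n) \<and> rep (V - nb x) (D + M')"
  proof -
    consider "x = a" | "x = a + int n - 1" | "a < x" "x < a + int n - 1"
      using *(1) by (force simp: ivl_def)
    then show ?thesis
    proof cases
      case 1
      have "(2, {#comp_of (a + 2) (n - 2)#}) \<in> opts p (comp_of a n)"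
        using x(3) n 1 by (cases "even n") (auto simp: comp_of_def elim!: evenE oddE)
      then show ?thesis using rep_end_left[OF *(4,3) n] 1 *(2) by fastforce
    next
      case 2
      have "(2, {#comp_of a (n - 2)#}) \<in> opts p (comp_of a n)"
        using x(3) n 2 by (cases "even n") (auto simp: comp_of_def elim!: evenE oddE)
      then show ?thesis using rep_end_right[OF *(4,3) n 2] *(2) by fastforce
    next
      case 3
      define i j where "i = nat (x - a - 1)" and "j = nat (a + int n - x - 2)"
      have ij: "i + j + 3 = n" "x = a + int i + 1" using 3 by (auto simp: i_def j_def)
      have "(3, {#comp_of a i, comp_of (x + 2) j#}) \<in> opts p (comp_of a n)"
      proof (cases "even i"; cases "even j")
        assume "even i" "even j"
        then obtain u v where uv: "i = 2 * u" "j = 2 * v" by (auto elim!: evenE)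
        have "n = 2 * (u + v + 1) + 1" using ij uv by simp
        then show ?thesis using x(3) ij(2) uv by (auto simp: comp_of_def)
      next
        assume "even i" "odd j"
        then obtain u v where uv: "i = 2 * u" "j = 2 * v + 1" by (auto elim!: evenE oddE)
        have "n = 2 * (u + v + 2)" using ij uv by simp
        then have "comp_of a i = Ev u" "comp_of (x + 2) j = Od p v" "comp_of a n = Ev (v + u + 2)"
          using x(3) ij(2) uv by (auto simp: comp_of_def)
        then show ?thesis using opts_Ev_mid[of v u "v + u + 2" p]
          by (simp only: add_mset_commute[of "Ev u"])
      next
        assume "odd i" "even j"
        then obtain u v where uv: "i = 2 * u + 1" "j = 2 * v" by (auto elim!: evenE oddE)
        have "n = 2 * (u + v + 2)" using ij uv by simp
        then show ?thesis using x(3) ij(2) uv by (auto simp: comp_of_def)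
      next
        assume "odd i" "odd j"
        then obtain u v where uv: "i = 2 * u + 1" "j = 2 * v + 1" by (auto elim!: oddE)
        have "n = 2 * (u + v + 2) + 1" using ij uv by simp
        then show ?thesis using x(3) ij(2) uv by (auto simp: comp_of_def)
      qed
      then show ?thesis using rep_mid[OF *(4,3) ij] *(2) by fastforce
    qed
  qed
  then obtain D where "(int (card (nb x \<inter> V)), D) \<in> opts p (comp_of a n)" "rep (V - nb x) (D + M')"
    by blast
  then show thesis using that M moves_add by blast
qed

lemma rep_moves:
  assumes "rep V M" "(k, N) \<in> moves p M"
  obtains x where "x \<in> movable p V" "k = int (card (nb x \<inter> V))" "rep (V - nb x) N"
proof -
  note found = that
  obtain c K D where M: "M = add_mset c K" and kD: "(k, D) \<in> opts p c" and N: "N = D + K"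
    using assms(2) by (auto elim: movesE)
  obtain a n V' where c: "c = comp_of a n" and V: "V = V' \<union> ivl a n" and ap: "apart V' (ivl a n)"
    and rV: "rep V' K"
    using rep_component[OF assms(1), of c] M by auto
  have n: "2 \<le> n" using opts_size[OF kD] c by auto
  have mv: "x \<in> movable p V" if "x \<in> ivl a n" "even x = p" for x
    using that n V by (auto simp: movable_def live_def ivl_def)
  have left: thesis if "even a = p" "k = 2" "D = {#comp_of (a + 2) (n - 2)#}"
    using that rep_end_left[OF rV ap n] mv[of a] n N V found
    by (auto simp: ivl_def)
  have right: thesis if "even (a + int n - 1) = p" "k = 2" "D = {#comp_of a (n - 2)#}"
    using that rep_end_right[OF rV ap n refl] mv[of "a + int n - 1"] n N V found
    by (auto simp: ivl_def)
  have mid: thesis if "even (a + int i + 1) = p" "k = 3" "i + j + 3 = n"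
      "D = {#comp_of a i, comp_of (a + int i + 1 + 2) j#}" for i j
    using that rep_mid[OF rV ap that(3) refl] mv[of "a + int i + 1"] N V found
    by (auto simp: ivl_def)
  show thesis
  proof (cases "even n")
    case True
    then obtain m where m: "n = 2 * m" by (elim evenE)
    have "c = Ev m" using c m by (simp add: comp_of_def)
    then consider r where "k = 2" "D = {#Ev r#}" "Suc r = m"
      | u v where "k = 3" "D = {#Od p u, Ev v#}" "u + v + 2 = m"
      using kD by auto
    then show thesis
    proof cases
      case 1
      then have "D = {#comp_of (a + 2) (n - 2)#}" "D = {#comp_of a (n - 2)#}"
        using m by (auto simp: comp_of_def)
      then show thesis using 1 left right m by (cases "even a = p") auto
    next
      case 2
      \<comment> \<open>The odd piece lies on the side of the end that \<open>p\<close> owns, which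
        is the left one exactly if \<open>even a = p\<close>.\<close>
      show thesis
      proof (cases "even a = p")
        case True
        then show thesis using 2 m by (intro mid[of "2 * u + 1" "2 * v"]) (auto simp: comp_of_def)
      next
        case False
        then show thesis using 2 m
          by (intro mid[of "2 * v" "2 * u + 1"]) (auto simp: comp_of_def add_mset_commute)
      qed
    qed
  next
    case False
    then obtain m where m: "n = 2 * m + 1" by (elim oddE)
    have cm: "c = Od (even a) m" using c m by (simp add: comp_of_def)
    show thesis
    proof (cases "even a = p")
      case True
      then consider r where "k = 2" "D = {#Od p r#}" "Suc r = m"
        | u v where "k = 3" "D = {#Od p u, Od p v#}" "u + v + 2 = m"
        using kD cm by auto
      then show thesis
      proof cases
        case 1
        then show thesis using True m by (intro left) (auto simp: comp_of_def)
      next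
        case 2
        then show thesis using True m
          by (intro mid[of "2 * u + 1" "2 * v + 1"]) (auto simp: comp_of_def)
      qed
    next
      case False
      then obtain u v where "k = 3" "D = {#Ev u, Ev v#}" "u + v + 1 = m" using kD cm by auto
      then show thesis using False m by (intro mid[of "2 * u" "2 * v"]) (auto simp: comp_of_def)
    qed
  qed
qed

lemma sval_rep: "rep V M \<Longrightarrow> sval p V = val p M"
proof (induction "card V" arbitrary: V M p rule: less_induct)
  case less
  have fin: "finite V" using less.prems rep_finite by blast
  have IH: "sval q (V - nb x) = val q N" if "x \<in> movable p V" "rep (V - nb x) N" for x N q
  proof -
    have "card (V - nb x) < card V"
      using that(1) fin movable_subset[of p V] self_in_nb[of x] by (intro psubset_card_mono) blast+
    then show ?thesis using less.hyps that by blast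
  qed
  show ?case
  proof (cases "live V = {}")
    case True
    then have "moves p M = {}" using rep_live_empty[OF less.prems] by (simp add: moves_empty_iff)
    then show ?thesis using True score_rep[OF less.prems] by (simp add: sval_terminal val_terminal)
  next
    case False
    obtain x where x: "x \<in> movable p V"
      "sval p V = int (card (nb x \<inter> V)) - sval (\<not> p) (V - nb x)"
      using sval_attained[OF fin False] .
    obtain k N where kN: "(k, N) \<in> moves p M" "k = int (card (nb x \<inter> V))" "rep (V - nb x) N"
      using rep_movable[OF less.prems x(1)] .
    have "sval p V \<le> val p M"
      using x kN IH[OF x(1) kN(3)] val_ge_moves[OF kN(1)] by simp
    moreover have "val p M \<le> sval p V"
    proof -
      obtain k N where kN: "(k, N) \<in> moves p M" "val p M = k - val (\<not> p) N"
        using val_attained[of p M] kN by blast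
      obtain x where x: "x \<in> movable p V" "k = int (card (nb x \<inter> V))" "rep (V - nb x) N"
        using rep_moves[OF less.prems kN(1)] .
      show ?thesis using kN x IH[OF x(1,3)] sval_ge[OF fin x(1)] by simp
    qed
    ultimately show ?thesis by simp
  qed
qed

section \<open>Milnor's inequalities and the cancellation of opposite components\<close>

lemma val_no_zugzwang: "0 \<le> val p M + val (\<not> p) M"
proof -
  obtain V where "rep V M" using rep_exists by blast
  then show ?thesis using sval_no_zugzwang[of V p] rep_finite sval_rep by simp
qed

lemma moves_union:
  "moves p (M + N) = (\<lambda>(k, D). (k, D + N)) ` moves p M \<union> (\<lambda>(k, D). (k, M + D)) ` moves p N"
proof (intro equalityI subsetI)
  fix m assume "m \<in> moves p (M + N)"
  then obtain c K k D where K: "M + N = add_mset c K" "(k, D) \<in> opts p c" "m = (k, D + K)"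
    by (rule movesE)
  then have "c \<in># M \<or> c \<in># N" by (metis union_iff union_single_eq_member)
  then show "m \<in> (\<lambda>(k, D). (k, D + N)) ` moves p M \<union> (\<lambda>(k, D). (k, M + D)) ` moves p N"
  proof
    assume "c \<in># M"
    then obtain M' where M: "M = add_mset c M'" by (blast dest: multi_member_split)
    then have "m = (k, (D + M') + N)" using K by simp
    then show ?thesis using M moves_add[OF K(2), of M'] by force
  next
    assume "c \<in># N"
    then obtain N' where N: "N = add_mset c N'" by (blast dest: multi_member_split)
    then have "m = (k, M + (D + N'))" using K by (simp add: ac_simps)
    then show ?thesis using N moves_add[OF K(2), of N'] by force
  qed
next
  fix m assume "m \<in> (\<lambda>(k, D). (k, D + N)) ` moves p M \<union> (\<lambda>(k, D). (k, M + D)) ` moves p N"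
  then show "m \<in> moves p (M + N)"
  proof
    assume "m \<in> (\<lambda>(k, D). (k, D + N)) ` moves p M"
    then obtain c K k D where K: "M = add_mset c K" "(k, D) \<in> opts p c" "m = (k, D + K + N)"
      by (auto elim: movesE)
    then show ?thesis using moves_add[OF K(2), of "K + N"] by (simp add: ac_simps)
  next
    assume "m \<in> (\<lambda>(k, D). (k, M + D)) ` moves p N"
    then obtain c K k D where K: "N = add_mset c K" "(k, D) \<in> opts p c" "m = (k, M + (D + K))"
      by (auto elim: movesE)
    then show ?thesis using moves_add[OF K(2), of "M + K"] by (simp add: ac_simps)
  qed
qed

text \<open>Milnor's inequalities for sums; they hold because moving is never a disadvantage.\<close>

lemma val_union:
  "val p (M + N) \<le> val p M + val p N"
  "val p M - val (\<not> p) N \<le> val p (M + N)"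
proof -
  have "(\<forall>p. val p (M + N) \<le> val p M + val p N) \<and> (\<forall>p. val p M - val (\<not> p) N \<le> val p (M + N))"
  proof (induction "msize M + msize N" arbitrary: M N rule: less_induct)
    case less
    have IH: "val p (M' + N') \<le> val p M' + val p N'" "val p M' - val (\<not> p) N' \<le> val p (M' + N')"
      if "msize M' + msize N' < msize M + msize N" for M' N' p
      using less that by auto
    have upper: "val p (M + N) \<le> val p M + val p N" for p
    proof (cases "moves p (M + N) = {}")
      case True
      then have "moves p M = {}" "moves p N = {}" by (auto simp: moves_union)
      then show ?thesis using True by (simp add: val_terminal)
    next
      case False
      then obtain k K where K: "(k, K) \<in> moves p (M + N)" "val p (M + N) = k - val (\<not> p) K"
        by (rule val_attained)
      from K(1) consider M' where "(k, M') \<in> moves p M" "K = M' + N"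
        | N' where "(k, N') \<in> moves p N" "K = M + N'"
        by (auto simp: moves_union)
      then show ?thesis
      proof cases
        case 1
        then have "val (\<not> p) M' - val p N \<le> val (\<not> p) K"
          using IH(2)[of M' N "\<not> p"] moves_size[OF 1(1)] by simp
        then show ?thesis using K val_ge_moves[OF 1(1)] by simp
      next
        case 2
        then have "val (\<not> p) N' - val p M \<le> val (\<not> p) K"
          using IH(2)[of N' M "\<not> p"] moves_size[OF 2(1)] by (simp add: add.commute)
        then show ?thesis using K val_ge_moves[OF 2(1)] by simp
      qed
    qed
    moreover have "val p M - val (\<not> p) N \<le> val p (M + N)" for p
    proof (cases "moves p M = {}")
      \<comment> \<open>Without a move in \<open>M\<close>, player \<open>p\<close> cannot open
        there. The upper bound for the opponent and the absence of zugzwang in the sum take the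
        place of that opening.\<close>
      case True
      then have "moves (\<not> p) M = {}" by (simp add: moves_empty_iff)
      then have "val (\<not> p) M = - val p M" using True by (simp add: val_terminal mscore_neg)
      then show ?thesis using upper[of "\<not> p"] val_no_zugzwang[of p "M + N"] by simp
    next
      case False
      then obtain k M' where K: "(k, M') \<in> moves p M" "val p M = k - val (\<not> p) M'"
        by (rule val_attained)
      have "(k, M' + N) \<in> moves p (M + N)" using K(1) by (force simp: moves_union)
      then have "k - val (\<not> p) (M' + N) \<le> val p (M + N)" by (rule val_ge_moves)
      moreover have "val (\<not> p) (M' + N) \<le> val (\<not> p) M' + val (\<not> p) N"
        using IH(1)[of M' N] moves_size[OF K(1)] by simp
      ultimately show ?thesis using K by simp
    qed
    ultimately show ?case by blast
  qed
  then show "val p (M + N) \<le> val p M + val p N" "val p M - val (\<not> p) N \<le> val p (M + N)"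
    by auto
qed

fun inv_comp :: "component \<Rightarrow> component" where
  "inv_comp (Ev n) = Ev n"
| "inv_comp (Od q n) = Od (\<not> q) n"

lemma opts_inv: "(k, D) \<in> opts p c \<Longrightarrow> (k, image_mset inv_comp D) \<in> opts (\<not> p) (inv_comp c)"
  by (cases c; auto split: if_splits; blast)

lemma inv_comp_inv [simp]: "inv_comp (inv_comp c) = c"
  by (cases c) auto

lemma image_inv_inv [simp]: "image_mset inv_comp (image_mset inv_comp M) = M"
  by (simp add: multiset.map_comp comp_def)

lemma moves_inv:
  assumes "(k, N) \<in> moves p M"
  shows "(k, image_mset inv_comp N) \<in> moves (\<not> p) (image_mset inv_comp M)"
proof -
  obtain c K D where "M = add_mset c K" "(k, D) \<in> opts p c" "N = D + K"
    using assms by (auto elim: movesE)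
  then show ?thesis using moves_add[OF opts_inv, of k D p c "image_mset inv_comp K"] by simp
qed

text \<open>The opponent repeats each move in the other copy with equal gain, so the mover gets at
  most 0. As this holds for both players, the absence of zugzwang forces equality.\<close>

lemma val_mirror: "val p (M + image_mset inv_comp M) = 0"
proof -
  have le: "val p (M + image_mset inv_comp M) \<le> 0" for p M
  proof (induction "msize M" arbitrary: M rule: less_induct)
    case less
    let ?W = "M + image_mset inv_comp M"
    show ?case
    proof (cases "moves p ?W = {}")
      case True
      have "mscore p ?W = 0"
      proof (induction M)
        case (add c M)
        then show ?case by (cases c) auto
      qed simp
      then show ?thesis using True by (simp add: val_terminal)
    next
      case False
      then obtain k K where K: "(k, K) \<in> moves p ?W" "val p ?W = k - val (\<not> p) K"
        by (rule val_attained)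
      obtain N where N: "(k, N + image_mset inv_comp N) \<in> moves (\<not> p) K" "msize N < msize M"
      proof -
        from K(1) consider N where "(k, N) \<in> moves p M" "K = N + image_mset inv_comp M"
          | N where "(k, N) \<in> moves p (image_mset inv_comp M)" "K = M + N"
          by (auto simp: moves_union)
        then show thesis
        proof cases
          case 1
          then show thesis
            using moves_inv[OF 1(1)] moves_size[OF 1(1)] that[of N] by (force simp: moves_union)
        next
          case 2
          then have m: "(k, image_mset inv_comp N) \<in> moves (\<not> p) M"
            using moves_inv[OF 2(1)] by simp
          then have "(k, image_mset inv_comp N + N) \<in> moves (\<not> p) K"
            using 2 by (force simp: moves_union)
          then show thesis using m moves_size[OF m] that[of "image_mset inv_comp N"] by simp
        qed
      qed
      have "k - val p (N + image_mset inv_comp N) \<le> val (\<not> p) K"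
        using val_ge_moves[OF N(1)] by simp
      then show ?thesis using K less[OF N(2)] by simp
    qed
  qed
  show ?thesis
    using le[of p M] le[of "\<not> p" M] val_no_zugzwang[of p "M + image_mset inv_comp M"] by simp
qed

text \<open>By the assumption \<open>N\<close> is worth the same to \<open>p\<close> whoever starts,
  so the two bounds of \<open>val_union\<close> coincide. This applies to opposite pairs and to
  components with at most one vertex.\<close>

lemma val_add_number:
  assumes "val p N + val (\<not> p) N = 0"
  shows "val p (N + M) = val p N + val p M"
proof -
  have "val p (M + N) = val p N + val p M" using val_union[of p M N] assms by linarith
  then show ?thesis by (simp add: union_commute)
qed

lemma val_Ev_Ev [simp]: "val p (add_mset (Ev n) (add_mset (Ev n) M)) = val p M"
  using val_mirror[of _ "{#Ev n#}"] val_add_number[of p "{#Ev n, Ev n#}" M] by simp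

lemma val_Od_Od [simp]:
  "val p (add_mset (Od q n) (add_mset (Od (\<not> q) n) M)) = val p M"
  "val p (add_mset (Od (\<not> q) n) (add_mset (Od q n) M)) = val p M"
  using val_mirror[of _ "{#Od q n#}"] val_add_number[of p "{#Od q n, Od (\<not> q) n#}" M]
  by (simp_all add: add_mset_commute)

lemma val_empty [simp]: "val p {#} = 0"
  by (simp add: val_terminal moves_empty_iff)

lemma val_Ev_0 [simp]: "val p (add_mset (Ev 0) M) = val p M"
  using val_add_number[of p "{#Ev 0#}" M] by (simp add: val_terminal moves_empty_iff)

lemma val_Od_0 [simp]: "val p (add_mset (Od q 0) M) = (if q = p then 1 else - 1) + val p M"
  using val_add_number[of p "{#Od q 0#}" M] by (auto simp: val_terminal moves_empty_iff)

text \<open>Each vertex finally contributes 1 or -1 to the difference, so the number of vertices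
  fixes its parity.\<close>

lemma even_val: "even (val p M - int (msize M))"
proof (induction "msize M" arbitrary: p M rule: less_induct)
  case less
  show ?case
  proof (cases "moves p M = {}")
    case True
    have "even (mscore p M - int (msize M))"
    proof (induction M)
      case (add c M)
      then show ?case by (cases c) auto
    qed simp
    then show ?thesis using True by (simp add: val_terminal)
  next
    case False
    then obtain k N where K: "(k, N) \<in> moves p M" "val p M = k - val (\<not> p) N"
      by (rule val_attained)
    then show ?thesis using moves_size[OF K(1)] less[of N "\<not> p"] by simp presburger
  qed
qed

lemma val_le:
  assumes "\<And>c K k D. M = add_mset c K \<Longrightarrow> (k, D) \<in> opts p c \<Longrightarrow> k - val (\<not> p) (D + K) \<le> b"
    and "mscore p M \<le> b"
  shows "val p M \<le> b"
proof (cases "moves p M = {}")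
  case True
  then show ?thesis using assms(2) by (simp add: val_terminal)
next
  case False
  then obtain k N where K: "(k, N) \<in> moves p M" "val p M = k - val (\<not> p) N"
    by (rule val_attained)
  then show ?thesis using assms(1) by (auto elim!: movesE)
qed

section \<open>Bounds for small sums\<close>

text \<open>\<open>val_Ev_0\<close> and \<open>val_Od_0\<close> see only the outermost element;
  these variants let the simplifier drop a small component one place further in.\<close>

lemma val_small_inner [simp]:
  "val p (add_mset c (add_mset (Ev 0) M)) = val p (add_mset c M)"
  "val p (add_mset c (add_mset (Od q 0) M)) = (if q = p then 1 else - 1) + val p (add_mset c M)"
  by (simp_all add: add_mset_commute[of c])

text \<open>The opponent can keep the outcome of each move of \<open>p\<close> in \<open>c\<close>, next to \<open>M\<close>, below \<open>b\<close>.\<close>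

definition answered :: "bool \<Rightarrow> int \<Rightarrow> component \<Rightarrow> component multiset \<Rightarrow> bool" where
  "answered p b c M \<longleftrightarrow> (\<forall>(k, D)\<in>opts p c. k - val (\<not> p) (D + M) \<le> b)"

lemma answered_Ev:
  assumes "\<And>m. Suc m = n \<Longrightarrow> 2 - b \<le> val (\<not> p) (add_mset (Ev m) M)"
    and "\<And>x y. x + y + 2 = n \<Longrightarrow> 3 - b \<le> val (\<not> p) (add_mset (Od p x) (add_mset (Ev y) M))"
  shows "answered p b (Ev n) M"
  using assms by (fastforce simp: answered_def)

lemma answered_own:
  assumes "\<And>m. Suc m = n \<Longrightarrow> 2 - b \<le> val (\<not> p) (add_mset (Od p m) M)"
    and "\<And>x y. x + y + 2 = n \<Longrightarrow> 3 - b \<le> val (\<not> p) (add_mset (Od p x) (add_mset (Od p y) M))"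
  shows "answered p b (Od p n) M"
  using assms by (fastforce simp: answered_def)

lemma answered_opp:
  assumes "\<And>x y. x + y + 1 = n \<Longrightarrow> 3 - b \<le> val (\<not> p) (add_mset (Ev x) (add_mset (Ev y) M))"
  shows "answered p b (Od (\<not> p) n) M"
  using assms by (fastforce simp: answered_def)

lemma val_le_single:
  assumes "answered p b c {#}" and "cscore p c \<le> b"
  shows "val p {#c#} \<le> b"
  using assms by (intro val_le) (auto simp: answered_def)

lemma val_le_pair:
  assumes "answered p b c {#d#}" "answered p b d {#c#}" and "cscore p c + cscore p d \<le> b"
  shows "val p {#c, d#} \<le> b"
  using assms by (intro val_le) (auto simp: answered_def add_eq_conv_ex)

lemma reply_Ev_end: "2 - val p (add_mset (Ev n) M) \<le> val (\<not> p) (add_mset (Ev (Suc n)) M)"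
  using val_ge[OF opts_Ev_end, of "\<not> p" n M] by simp

lemma reply_Ev_mid:
  "a + b + 2 = n \<Longrightarrow>
     3 - val p (add_mset (Od (\<not> p) a) (add_mset (Ev b) M)) \<le> val (\<not> p) (add_mset (Ev n) M)"
  using val_ge[OF opts_Ev_mid, of a b n "\<not> p" M] by simp

lemma reply_own_end:
  "2 - val p (add_mset (Od (\<not> p) n) M) \<le> val (\<not> p) (add_mset (Od (\<not> p) (Suc n)) M)"
  using val_ge[OF opts_own_end, of "\<not> p" n M] by simp

lemma reply_own_mid:
  "a + b + 2 = n \<Longrightarrow>
     3 - val p (add_mset (Od (\<not> p) a) (add_mset (Od (\<not> p) b) M))
       \<le> val (\<not> p) (add_mset (Od (\<not> p) n) M)"
  using val_ge[OF opts_own_mid, of a b n "\<not> p" M] by simp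

lemma reply_opp:
  "a + b + 1 = n \<Longrightarrow>
     3 - val p (add_mset (Ev a) (add_mset (Ev b) M)) \<le> val (\<not> p) (add_mset (Od p n) M)"
  using val_ge[OF opts_opp, of p "\<not> p" a b n M] by simp

text \<open>In this and the next three lemmas the cut is chosen so that one piece is opposite to a
  component already on the board; only the other piece and \<open>M\<close> remain.\<close>

lemma reply_Ev_cancel_Od:
  "a + b + 2 = n \<Longrightarrow>
     3 - val p (add_mset (Ev b) M) \<le> val (\<not> p) (add_mset (Ev n) (add_mset (Od p a) M))"
  using reply_Ev_mid[of a b n p "add_mset (Od p a) M"] by (simp add: add_mset_commute[of "Ev b"])

lemma reply_Ev_cancel_Ev:
  "a + b + 2 = n \<Longrightarrow>
     3 - val p (add_mset (Od (\<not> p) a) M) \<le> val (\<not> p) (add_mset (Ev n) (add_mset (Ev b) M))"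
  using reply_Ev_mid[of a b n p "add_mset (Ev b) M"]
  by (simp add: add_mset_commute[of "Od (\<not> p) a"])

lemma reply_opp_cancel:
  "a + b + 1 = n \<Longrightarrow>
     3 - val p (add_mset (Ev b) M) \<le> val (\<not> p) (add_mset (Od p n) (add_mset (Ev a) M))"
  using reply_opp[of a b n p "add_mset (Ev a) M"] by (simp add: add_mset_commute[of "Ev b"])

lemma reply_own_cancel:
  "a + b + 2 = n \<Longrightarrow>
     3 - val p (add_mset (Od (\<not> p) b) M)
       \<le> val (\<not> p) (add_mset (Od (\<not> p) n) (add_mset (Od p a) M))"
  using reply_own_mid[of a b n p "add_mset (Od p a) M"]
  by (simp add: add_mset_commute[of "Od (\<not> p) b"])

text \<open>
  In the estimates below, every move is answered so that two components become opposite and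
  cancel, which leaves a smaller position of a kind that is estimated as well.
\<close>

lemma val_consecutive:
  "val p {#Ev n, Ev (Suc n)#} \<le> 2" "val p {#Od p (Suc n), Od (\<not> p) n#} \<le> 2"
proof -
  have "val p {#Ev n, Ev (Suc n)#} \<le> 2 \<and> val p {#Od p (Suc n), Od (\<not> p) n#} \<le> 2"
  proof (induction n rule: less_induct)
    case (less n)
    have IH1: "val p {#Ev m, Ev (Suc m)#} \<le> 2" if "m < n" for m
      using less that by blast
    have IH2: "val p {#Od p (Suc m), Od (\<not> p) m#} \<le> 2" if "m < n" for m
      using less that by blast
    have "answered p 2 (Ev n) {#Ev (Suc n)#}"
    proof (rule answered_Ev, goal_cases)
      case (1 m)
      then show ?case using reply_Ev_cancel_Ev[of 0 m "Suc n" p "{#}"]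
        by (simp add: add_mset_commute)
    next
      case (2 x y)
      then show ?case
        using reply_Ev_cancel_Od[of x "Suc y" "Suc n" p "{#Ev y#}"] IH1[of y]
        by (simp add: add_mset_commute)
    qed
    moreover have "answered p 2 (Ev (Suc n)) {#Ev n#}"
    proof (rule answered_Ev, goal_cases)
      case (2 x y)
      show ?case
      proof (cases y)
        case (Suc z)
        then show ?thesis
          using 2 reply_Ev_cancel_Od[of x z n p "{#Ev (Suc z)#}"] IH1[of z]
          by (simp add: add_mset_commute)
      next
        \<comment> \<open>Now x = n - 1, so \<open>Ev n\<close> is too short by one to cancel
          \<open>Od p x\<close>. A cut with an empty even piece leaves two consecutive odd segments
          instead, which is why both bounds are proved in one induction.\<close>
        case y: 0
        show ?thesis
        proof (cases x)
          case 0
          then have "n = Suc 0" using 2 y by simp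
          then show ?thesis using reply_Ev_end[of p 0 "{#}"] y 0 by simp
        next
          case (Suc z)
          then have n: "n = Suc (Suc z)" using 2 y by simp
          then show ?thesis
            using reply_Ev_mid[of z 0 n p "{#Od p (Suc z)#}"] IH2[of z] y Suc
            by (simp add: add_mset_commute)
        qed
      qed
    qed simp
    moreover have "answered p 2 (Od p (Suc n)) {#Od (\<not> p) n#}"
    proof (rule answered_own, goal_cases)
      case (2 x y)
      show ?case
      proof (cases y)
        case (Suc z)
        then show ?thesis
          using 2 reply_own_cancel[of x z n p "{#Od p (Suc z)#}"] IH2[of z]
          by (simp add: add_mset_commute)
      next
        case y: 0
        show ?thesis
        proof (cases x)
          case 0
          then have "n = Suc 0" using 2 y by simp
          then show ?thesis using reply_own_end[of p 0 "{#}"] y 0 by simp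
        next
          case (Suc z)
          then show ?thesis
            using 2 y reply_own_cancel[of 0 z n p "{#Od p (Suc z)#}"] IH2[of z]
            by (simp add: add_mset_commute)
        qed
      qed
    qed simp
    moreover have "answered p 2 (Od (\<not> p) n) {#Od p (Suc n)#}"
    proof (rule answered_opp, goal_cases)
      case (1 x y)
      then show ?case
        using reply_opp_cancel[of x "Suc y" "Suc n" p "{#Ev y#}"] IH1[of y]
        by (simp add: add_mset_commute)
    qed
    ultimately show ?case by (auto intro!: val_le_pair)
  qed
  then show "val p {#Ev n, Ev (Suc n)#} \<le> 2" "val p {#Od p (Suc n), Od (\<not> p) n#} \<le> 2"
    by auto
qed

text \<open>Against \<open>Od p a\<close>, the segment \<open>Ev b\<close> admits a cancelling cut
  from b = a + 2 on, and \<open>Od p a\<close> admits one against \<open>Ev b\<close> from a = b + 1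
  on. The first two cases are the gap in between.\<close>

lemma nat_trichotomy_gap:
  fixes a b :: nat
  obtains "b = a" | "b = Suc a" | m where "b = a + m + 2" | m where "a = b + m + 1"
proof -
  have "b = a \<or> b = Suc a \<or> b = a + (b - a - 2) + 2 \<or> a = b + (a - b - 1) + 1" by arith
  then show thesis using that by blast
qed

text \<open>The bound reproduces itself: the reply to a cut gains 3 as well and leaves a smaller
  segment of the same kind, again worth at most 3 to \<open>p\<close>. Pieces that differ by one are
  levelled by an end move.\<close>

lemma val_opp_le: "val p {#Od (\<not> p) n#} \<le> 3"
  and val_Ev_pair_ge: "0 \<le> val (\<not> p) {#Ev a, Ev b#}"
proof -
  have pair: "0 \<le> val (\<not> p) {#Ev a, Ev b#}"
    if IH: "\<And>m. m < a + b \<Longrightarrow> val p {#Od (\<not> p) m#} \<le> 3" for a b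
  proof (rule nat_trichotomy_gap[of b a])
    assume "b = Suc a"
    then show ?thesis using reply_Ev_end[of p a "{#Ev a#}"] by (simp add: add_mset_commute)
  next
    fix m assume "b = a + m + 2"
    then show ?thesis using reply_Ev_cancel_Ev[of m a b p "{#}"] IH[of m]
      by (simp add: add_mset_commute)
  next
    fix m assume a: "a = b + m + 1"
    show ?thesis
    proof (cases m)
      case 0
      then show ?thesis using a reply_Ev_end[of p b "{#Ev b#}"] by simp
    next
      case (Suc k)
      then show ?thesis using a reply_Ev_cancel_Ev[of k b a p "{#}"] IH[of k] by simp
    qed
  qed simp
  have opp: "val p {#Od (\<not> p) n#} \<le> 3" for n
  proof (induction n rule: less_induct)
    case (less n)
    have "answered p 3 (Od (\<not> p) n) {#}"
    proof (rule answered_opp, goal_cases)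
      case (1 x y)
      then show ?case using pair[of x y] less by simp
    qed
    then show ?case by (intro val_le_single) auto
  qed
  show "val p {#Od (\<not> p) n#} \<le> 3" by (rule opp)
  show "0 \<le> val (\<not> p) {#Ev a, Ev b#}" using pair opp by blast
qed

text \<open>An even \<open>n\<close> admits no equal halves; the halves \<open>Ev a\<close> and
  \<open>Ev (Suc a)\<close> cost at most 2 by \<open>val_consecutive\<close>, which leaves 3 -
  2.\<close>

lemma val_opp_ge:
  "odd n \<Longrightarrow> 3 \<le> val p {#Od (\<not> p) n#}"
  "0 < n \<Longrightarrow> 1 \<le> val p {#Od (\<not> p) n#}"
proof -
  show *: "3 \<le> val p {#Od (\<not> p) n#}" if "odd n"
  proof -
    obtain a where "n = 2 * a + 1" using \<open>odd n\<close> by (elim oddE)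
    then show ?thesis using reply_opp[of a a n "\<not> p" "{#}"] by simp
  qed
  show "1 \<le> val p {#Od (\<not> p) n#}" if "0 < n"
  proof (cases "odd n")
    case False
    then obtain b where "n = 2 * b" by (auto elim: evenE)
    moreover from this obtain a where "b = Suc a" using \<open>0 < n\<close> by (cases b) auto
    ultimately show ?thesis
      using reply_opp[of a "Suc a" n "\<not> p" "{#}"] val_consecutive(1)[of "\<not> p" a] by simp
  qed (use * in simp)
qed

text \<open>These pairs are what the most balanced middle cut of an even segment leaves to the other
  player. The bound 1 gives the 3 - 1 in \<open>val_Ev_ge\<close>.\<close>

lemma val_opp_Ev_le:
  "val p {#Od (\<not> p) n, Ev n#} \<le> 1" "val p {#Od (\<not> p) n, Ev (Suc n)#} \<le> 1"
proof -
  have "val p {#Od (\<not> p) n, Ev n#} \<le> 1 \<and> val p {#Od (\<not> p) n, Ev (Suc n)#} \<le> 1"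
  proof (induction n rule: less_induct)
    case (less n)
    have IH1: "val p {#Od (\<not> p) m, Ev m#} \<le> 1" if "m < n" for m
      using less that by blast
    have IH2: "val p {#Od (\<not> p) m, Ev (Suc m)#} \<le> 1" if "m < n" for m
      using less that by blast
    have "answered p 1 (Od (\<not> p) n) {#Ev n#}"
    proof (rule answered_opp, goal_cases)
      case (1 x y)
      show ?case
      proof (cases y)
        case (Suc z)
        then show ?thesis
          using 1 reply_Ev_cancel_Ev[of z x n p "{#Ev (Suc z)#}"] IH2[of z]
          by (simp add: add_mset_commute)
      next
        case y: 0
        show ?thesis
        proof (cases x)
          case 0
          then show ?thesis using 1 y reply_Ev_end[of p 0 "{#}"] by simp
        next
          case (Suc z)
          then show ?thesis
            using 1 y reply_Ev_cancel_Ev[of z 0 n p "{#Ev (Suc z)#}"] IH2[of z]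
            by (simp add: add_mset_commute)
        qed
      qed
    qed
    moreover have "answered p 1 (Ev n) {#Od (\<not> p) n#}"
    proof (rule answered_Ev, goal_cases)
      case (1 m)
      then show ?case using reply_own_end[of p m "{#Ev m#}"] IH1[of m]
        by (simp add: add_mset_commute)
    next
      case (2 x y)
      then show ?case
        using reply_own_cancel[of x y n p "{#Ev y#}"] IH1[of y] by (simp add: add_mset_commute)
    qed
    moreover have "answered p 1 (Od (\<not> p) n) {#Ev (Suc n)#}"
    proof (rule answered_opp, goal_cases)
      case (1 x y)
      then show ?case
        using reply_Ev_cancel_Ev[of y x "Suc n" p "{#Ev y#}"] IH1[of y]
        by (simp add: add_mset_commute)
    qed
    moreover have "answered p 1 (Ev (Suc n)) {#Od (\<not> p) n#}"
    proof (rule answered_Ev, goal_cases)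
      case (1 m)
      show ?case
      proof (cases n)
        case 0
        then show ?thesis using 1 by simp
      next
        case (Suc z)
        then show ?thesis using 1 reply_own_end[of p z "{#Ev n#}"] IH2[of z]
          by (simp add: add_mset_commute)
      qed
    next
      case (2 x y)
      show ?case
      proof (cases y)
        case 0
        then show ?thesis using 2 reply_own_end[of p x "{#Od p x#}"]
          by (auto simp: add_mset_commute)
      next
        case (Suc z)
        then show ?thesis using 2 reply_own_cancel[of x z n p "{#Ev (Suc z)#}"] IH2[of z]
          by (simp add: add_mset_commute)
      qed
    qed
    ultimately show ?case by (auto intro!: val_le_pair)
  qed
  then show "val p {#Od (\<not> p) n, Ev n#} \<le> 1" "val p {#Od (\<not> p) n, Ev (Suc n)#} \<le> 1"
    by auto
qed

text \<open>After a middle cut the opponent has to keep the loss on \<open>Od p a\<close> and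
  \<open>Ev b\<close> down to 1. In the gap cases, small values apart, a cut with one empty piece
  leaves a consecutive pair, which \<open>val_consecutive\<close> bounds.\<close>

lemma val_Ev_le: "val p {#Ev n#} \<le> 4"
  and val_own_Ev_ge: "- 1 \<le> val (\<not> p) {#Od p a, Ev b#}"
proof -
  have pair: "- 1 \<le> val (\<not> p) {#Od p a, Ev b#}"
    if IH: "\<And>m. m < a + b \<Longrightarrow> val p {#Ev m#} \<le> 4" for a b
  proof (rule nat_trichotomy_gap[of b a])
    assume ab: "b = a"
    show ?thesis
    proof (cases a)
      case (Suc z)
      then show ?thesis
        using ab reply_opp[of z 0 a p "{#Ev a#}"] val_consecutive(1)[of p z] by simp
    qed (simp add: ab)
  next
    assume ab: "b = Suc a"
    show ?thesis
    proof (cases a)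
      case 0
      then show ?thesis using ab reply_Ev_end[of p 0 "{#}"] by simp
    next
      case (Suc z)
      then show ?thesis
        using ab reply_Ev_mid[of z 0 b p "{#Od p a#}"] val_consecutive(2)[of p z]
        by (simp add: add_mset_commute)
    qed
  next
    fix m assume "b = a + m + 2"
    then show ?thesis using reply_Ev_cancel_Od[of a m b p "{#}"] IH[of m]
      by (simp add: add_mset_commute)
  next
    fix m assume "a = b + m + 1"
    then show ?thesis using reply_opp_cancel[of b m a p "{#}"] IH[of m] by simp
  qed
  have Ev: "val p {#Ev n#} \<le> 4" for n
  proof (induction n rule: less_induct)
    case (less n)
    have "answered p 4 (Ev n) {#}"
    proof (rule answered_Ev, goal_cases)
      case (1 m)
      then show ?case using val_Ev_pair_ge[of p m 0] by simp
    next
      case (2 x y)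
      then show ?case using pair[of x y] less by simp
    qed
    then show ?case by (intro val_le_single) auto
  qed
  show "val p {#Ev n#} \<le> 4" by (rule Ev)
  show "- 1 \<le> val (\<not> p) {#Od p a, Ev b#}" using pair Ev by blast
qed

text \<open>A middle cut uses up 2 of the parameter; the rest is divided into halves that differ by
  at most one. Only n = 1 leaves no room for such a cut.\<close>

lemma nat_double_gap:
  assumes "0 < (n :: nat)"
  obtains "n = 1" | a where "n = a + a + 2" | a where "n = a + Suc a + 2"
proof -
  have "n = 1 \<or> n = (n - 2) div 2 + (n - 2) div 2 + 2 \<or> n = (n - 3) div 2 + Suc ((n - 3) div 2) + 2"
    using assms by presburger
  then show thesis using that by blast
qed

lemma val_Ev_ge:
  assumes "0 < n"
  shows "2 \<le> val p {#Ev n#}"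
proof (rule nat_double_gap[OF assms])
  assume "n = 1"
  then show ?thesis using reply_Ev_end[of "\<not> p" 0 "{#}"] by simp
next
  fix a assume "n = a + a + 2"
  then show ?thesis
    using reply_Ev_mid[of a a n "\<not> p" "{#}"] val_opp_Ev_le(1)[of "\<not> p" a] by simp
next
  fix a assume "n = a + Suc a + 2"
  then show ?thesis
    using reply_Ev_mid[of a "Suc a" n "\<not> p" "{#}"] val_opp_Ev_le(2)[of "\<not> p" a] by simp
qed

text \<open>These are the gap pairs, where neither segment can be cut to cancel the other. Here
  \<open>val_own_own_Ev_ge\<close> needs something better than the general bound 5.\<close>

lemma val_own_Ev_le_3:
  "val p {#Od p n, Ev n#} \<le> 3" "val p {#Od p n, Ev (Suc n)#} \<le> 3"
proof -
  have "val p {#Od p n, Ev n#} \<le> 3 \<and> val p {#Od p n, Ev (Suc n)#} \<le> 3"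
  proof (induction n rule: less_induct)
    case (less n)
    have IH1: "val p {#Od p m, Ev m#} \<le> 3" if "m < n" for m
      using less that by blast
    have IH2: "val p {#Od p m, Ev (Suc m)#} \<le> 3" if "m < n" for m
      using less that by blast
    have "answered p 3 (Od p n) {#Ev n#}"
    proof (rule answered_own, goal_cases)
      case (1 m)
      then show ?case using val_own_Ev_ge[of p m n] by simp
    next
      case (2 x y)
      then show ?case
        using reply_Ev_cancel_Od[of x y n p "{#Od p y#}"] IH1[of y] by (simp add: add_mset_commute)
    qed
    moreover have "answered p 3 (Ev n) {#Od p n#}"
    proof (rule answered_Ev, goal_cases)
      case (1 m)
      then show ?case using val_own_Ev_ge[of p n m] by (simp add: add_mset_commute)
    next
      case (2 x y)
      then show ?case
        using reply_opp_cancel[of y "Suc x" n p "{#Od p x#}"] IH2[of x]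
        by (simp add: add_mset_commute)
    qed
    moreover have "answered p 3 (Od p n) {#Ev (Suc n)#}"
    proof (rule answered_own, goal_cases)
      case (1 m)
      then show ?case using val_own_Ev_ge[of p m "Suc n"] by simp
    next
      case (2 x y)
      then show ?case
        using reply_Ev_cancel_Od[of x "Suc y" "Suc n" p "{#Od p y#}"] IH2[of y]
        by (simp add: add_mset_commute)
    qed
    moreover have "answered p 3 (Ev (Suc n)) {#Od p n#}"
    proof (rule answered_Ev, goal_cases)
      case (1 m)
      then show ?case using val_own_Ev_ge[of p n m] by (simp add: add_mset_commute)
    next
      case (2 x y)
      then show ?case
        using reply_opp_cancel[of y x n p "{#Od p x#}"] IH1[of x] by (simp add: add_mset_commute)
    qed
    ultimately show ?case by (auto intro!: val_le_pair)
  qed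
  then show "val p {#Od p n, Ev n#} \<le> 3" "val p {#Od p n, Ev (Suc n)#} \<le> 3"
    by auto
qed

text \<open>Cancelling an odd segment against the even one gives 3 - 5. If \<open>c\<close> is in
  the gap for both \<open>a\<close> and \<open>b\<close>, Milnor's lower bound separates one
  nonsingleton odd segment, worth at least 1 to the opponent who starts, from a pair worth at most 3
  to \<open>p\<close>: 1 - 3. \<open>IH\<close> is supplied by the induction in
  \<open>val_own_Ev_le_5\<close>.\<close>

lemma val_own_own_Ev_ge:
  assumes IH: "\<And>x y. x + y < a + b + c \<Longrightarrow> val p {#Od p x, Ev y#} \<le> 5"
  shows "- 2 \<le> val (\<not> p) {#Od p a, Od p b, Ev c#}"
proof -
  have far: "- 2 \<le> val (\<not> p) {#Od p a, Od p b, Ev c#}"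
    if IH: "\<And>x y. x + y < a + b + c \<Longrightarrow> val p {#Od p x, Ev y#} \<le> 5" and "c \<noteq> a" "c \<noteq> Suc a"
    for a b c
  proof (rule nat_trichotomy_gap[of c a])
    fix m assume "c = a + m + 2"
    then show ?thesis using reply_Ev_cancel_Od[of a m c p "{#Od p b#}"] IH[of b m]
      by (simp add: add_mset_commute)
  next
    fix m assume "a = c + m + 1"
    then show ?thesis using reply_opp_cancel[of c m a p "{#Od p b#}"] IH[of b m]
      by (simp add: add_mset_commute)
  qed (use that in auto)
  have near: "- 2 \<le> val (\<not> p) {#Od p a, Od p b, Ev c#}"
    if "0 < b" "c = a \<or> c = Suc a" for a b c
  proof -
    have "val (\<not> p) {#Od p b#} - val p {#Od p a, Ev c#} \<le> val (\<not> p) {#Od p b, Od p a, Ev c#}"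
      using val_union(2)[of "\<not> p" "{#Od p b#}" "{#Od p a, Ev c#}"] by (simp add: add_mset_commute)
    moreover have "val p {#Od p a, Ev c#} \<le> 3" using that val_own_Ev_le_3 by blast
    moreover have "1 \<le> val (\<not> p) {#Od p b#}" using val_opp_ge(2)[of b "\<not> p"] that by simp
    ultimately show ?thesis by (simp add: add_mset_commute)
  qed
  have swap: "{#Od p b, Od p a, Ev c#} = {#Od p a, Od p b, Ev c#}" by (simp add: add_mset_commute)
  consider "c \<noteq> a" "c \<noteq> Suc a" | "c \<noteq> b" "c \<noteq> Suc b" | "0 < b" "c = a \<or> c = Suc a"
    | "0 < a" "c = b \<or> c = Suc b" | "a = 0" "b = 0" "c = 0 \<or> c = 1"
    by auto
  then show ?thesis
  proof cases
    case 1
    then show ?thesis using far IH by blast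
  next
    case 2
    then show ?thesis using far[of b a c] IH by (simp add: swap add.commute add.left_commute)
  next
    case 3
    then show ?thesis by (rule near)
  next
    case 4
    then show ?thesis using near[of a c b] by (simp add: swap)
  next
    case 5
    then show ?thesis using reply_Ev_end[of p 0 "{#}"] by auto
  qed
qed

text \<open>A single \<open>Od p n\<close> does not support an induction: a middle cut makes two own
  odd segments, and the reply turns one of them into an even one. Adding \<open>Ev b\<close> gives a
  family closed under this exchange; b = 0 is the case of interest.\<close>

lemma val_own_Ev_le_5: "val p {#Od p a, Ev b#} \<le> 5"
proof (induction "a + b" arbitrary: a b rule: less_induct)
  case less
  have IH: "- 2 \<le> val (\<not> p) {#Od p x, Od p y, Ev z#}" if "x + y + z < a + b" for x y z
    using that less by (intro val_own_own_Ev_ge) auto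
  have "answered p 5 (Od p a) {#Ev b#}"
  proof (rule answered_own, goal_cases)
    case (1 m)
    then show ?case using val_own_Ev_ge[of p m b] by simp
  next
    case (2 x y)
    then show ?case using IH[of x y b] by simp
  qed
  moreover have "answered p 5 (Ev b) {#Od p a#}"
  proof (rule answered_Ev, goal_cases)
    case (1 m)
    then show ?case using val_own_Ev_ge[of p a m] by (simp add: add_mset_commute)
  next
    case (2 x y)
    then show ?case using IH[of x a y] by (simp add: add_mset_commute)
  qed
  ultimately show ?case by (auto intro!: val_le_pair)
qed

lemma val_own_le: "val p {#Od p n#} \<le> 5"
  using val_own_Ev_le_5[of p n 0] by simp

text \<open>In the main replies nothing cancels. A cut of one segment into \<open>Ev x\<close> and
  \<open>Ev y\<close> is answered by a cut of the other into pieces of matching size; the result is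
  two pairs as in \<open>val_opp_Ev_le\<close>, each worth at most 1, and Milnor's upper bound adds
  them.\<close>

lemma val_opp_opp_le:
  "val p {#Od (\<not> p) n, Od (\<not> p) n#} \<le> 2" "val p {#Od (\<not> p) n, Od (\<not> p) (Suc n)#} \<le> 2"
proof -
  have two: "val p {#Od (\<not> p) u, Od (\<not> p) w, Ev x, Ev y#} \<le> 2"
    if "x = u \<or> x = Suc u" "y = w \<or> y = Suc w" for u w x y
  proof -
    have eq: "{#Od (\<not> p) u, Od (\<not> p) w, Ev x, Ev y#} = {#Od (\<not> p) u, Ev x#} + {#Od (\<not> p) w, Ev y#}"
      by (simp add: add_mset_commute)
    have "val p {#Od (\<not> p) u, Ev x#} \<le> 1" "val p {#Od (\<not> p) w, Ev y#} \<le> 1"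
      using that val_opp_Ev_le by blast+
    then show ?thesis
      unfolding eq
      using val_union(1)[of p "{#Od (\<not> p) u, Ev x#}" "{#Od (\<not> p) w, Ev y#}"] by linarith
  qed
  have "answered p 2 (Od (\<not> p) n) {#Od (\<not> p) n#}"
  proof (rule answered_opp, goal_cases)
    case (1 x y)
    show ?case
    proof (cases y)
      case (Suc z)
      then show ?thesis
        using 1 reply_own_mid[of x z n p "{#Ev x, Ev y#}"] two[of x x y z]
        by (simp add: add_mset_commute)
    next
      case y: 0
      show ?thesis
      proof (cases x)
        case 0
        then show ?thesis using 1 y reply_own_end[of p 0 "{#}"] by simp
      next
        case (Suc z)
        then show ?thesis
          using 1 y reply_own_mid[of z 0 n p "{#Ev x, Ev 0#}"] two[of x z 0 0]
          by (simp add: add_mset_commute)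
      qed
    qed
  qed
  then show "val p {#Od (\<not> p) n, Od (\<not> p) n#} \<le> 2" by (intro val_le_pair) auto
  have "answered p 2 (Od (\<not> p) n) {#Od (\<not> p) (Suc n)#}"
  proof (rule answered_opp, goal_cases)
    case (1 x y)
    then show ?case
      using reply_own_mid[of x y "Suc n" p "{#Ev x, Ev y#}"] two[of x x y y]
      by (simp add: add_mset_commute)
  qed
  moreover have "answered p 2 (Od (\<not> p) (Suc n)) {#Od (\<not> p) n#}"
  proof (rule answered_opp, goal_cases)
    case (1 x y)
    \<comment> \<open>If \<open>x\<close> or \<open>y\<close> is 0, the other segment cannot be cut
      into pieces one smaller than both. An end move then produces a single matched pair, for 2 -
      1.\<close>
    have end': "1 \<le> val (\<not> p) {#Ev n, Od (\<not> p) n#}"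
    proof (cases n)
      case (Suc z)
      then show ?thesis using reply_own_end[of p z "{#Ev n#}"] val_opp_Ev_le(2)[of p z]
        by (simp add: add_mset_commute)
    qed simp
    show ?case
    proof (cases "x = 0 \<or> y = 0")
      case True
      then show ?thesis using 1 end' by auto
    next
      case False
      then obtain u w where "x = Suc u" "y = Suc w" by (cases x; cases y) auto
      then show ?thesis
        using 1 reply_own_mid[of u w n p "{#Ev x, Ev y#}"] two[of x u y w]
        by (simp add: add_mset_commute)
    qed
  qed
  ultimately show "val p {#Od (\<not> p) n, Od (\<not> p) (Suc n)#} \<le> 2" by (intro val_le_pair) auto
qed

lemma val_own_ge:
  assumes "0 < n"
  shows "1 \<le> val p {#Od p n#}"
proof (rule nat_double_gap[OF assms])
  assume "n = 1"
  then show ?thesis using reply_own_end[of "\<not> p" 0 "{#}"] by simp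
next
  fix a assume "n = a + a + 2"
  then show ?thesis
    using reply_own_mid[of a a n "\<not> p" "{#}"] val_opp_opp_le(1)[of "\<not> p" a] by simp
next
  fix a assume "n = a + Suc a + 2"
  then show ?thesis
    using reply_own_mid[of a "Suc a" n "\<not> p" "{#}"] val_opp_opp_le(2)[of "\<not> p" a] by simp
qed

section \<open>Scores of segments\<close>

lemma segment_on_simps [simp]:
  "vertices (segment_on V) = V" "left (segment_on V) = {k \<in> V. even k}"
  "right (segment_on V) = {k \<in> V. odd k}"
  by (auto simp: segment_on_def right_def)

lemma remove_segment_on: "remove (segment_on V) S = segment_on (V - S)"
  by (auto simp: remove_def segment_on_def induce_subgraph_def with_proj_def)

lemma segment_arc:
  "u \<rightarrow>\<^bsub>dig (segment_on V)\<^esub> v \<longleftrightarrow> u \<in> V \<and> v \<in> V \<and> even u \<and> (v = u + 1 \<or> v = u - 1)"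
  by (auto simp: segment_on_def elim!: evenE)

lemma is_position_segment_on:
  assumes "finite V"
  shows "is_position (segment_on V)"
proof -
  obtain a b where ab: "V \<subseteq> {a..b}" "a < b"
  proof -
    obtain m where "\<And>v. v \<in> V \<Longrightarrow> \<bar>v\<bar> \<le> m"
      using finite_imageI[OF assms, of abs] bdd_above_finite[of "abs ` V"]
      by (auto simp: bdd_above_def)
    then have "V \<subseteq> {- \<bar>m\<bar> - 1..\<bar>m\<bar> + 1}" by fastforce
    then show thesis using that by force
  qed
  then have "is_position (segment_on {a..b})"
    using segment_relevant[of "segment_on {a..b}"] by (auto simp: is_segment_def relevant_def)
  then have "is_position (remove (segment_on {a..b}) ({a..b} - V))" by (rule is_position_remove)
  moreover have "{a..b} - ({a..b} - V) = V" using ab by auto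
  ultimately show ?thesis by (simp add: remove_segment_on)
qed

text \<open>Arcs lead from even to odd integers, so no path has two arcs. This is why a move of
  either player removes a closed neighbourhood.\<close>

lemma segment_reachable:
  assumes "finite V"
  shows "u \<rightarrow>\<^sup>*\<^bsub>dig (segment_on V)\<^esub> v \<longleftrightarrow>
    u \<in> V \<and> v \<in> V \<and> (v = u \<or> even u \<and> (v = u + 1 \<or> v = u - 1))"
proof -
  interpret fin_digraph "dig (segment_on V)"
    using is_position_segment_on[OF assms] by (simp add: is_position_def)
  show ?thesis
  proof
    assume "u \<rightarrow>\<^sup>*\<^bsub>dig (segment_on V)\<^esub> v"
    then show "u \<in> V \<and> v \<in> V \<and> (v = u \<or> even u \<and> (v = u + 1 \<or> v = u - 1))"
      by (induct rule: reachable_induct) (auto simp: segment_arc)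
  next
    assume "u \<in> V \<and> v \<in> V \<and> (v = u \<or> even u \<and> (v = u + 1 \<or> v = u - 1))"
    then show "u \<rightarrow>\<^sup>*\<^bsub>dig (segment_on V)\<^esub> v"
      using reachable_adjI[of u v] by (auto simp: segment_arc)
  qed
qed

lemma Succ_segment_on: "finite V \<Longrightarrow> x \<in> V \<Longrightarrow> even x \<Longrightarrow> Succ (segment_on V) x = nb x \<inter> V"
  by (auto simp: Succ_def segment_reachable nb_def)

lemma Pred_segment_on: "finite V \<Longrightarrow> x \<in> V \<Longrightarrow> odd x \<Longrightarrow> Pred (segment_on V) x = nb x \<inter> V"
  by (auto simp: Pred_def segment_reachable nb_def)

text \<open>All neighbours of a vertex belong to the other player, so a vertex is forced exactly
  when it has none.\<close>

lemma Forc_segment_on: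
  assumes "finite V"
  shows "Forc (segment_on V) = V - live V"
proof (intro set_eqI)
  fix x
  consider "x \<notin> V" | "x \<in> V" "even x" | "x \<in> V" "odd x" by blast
  then show "x \<in> Forc (segment_on V) \<longleftrightarrow> x \<in> V - live V"
  proof cases
    case 1
    then show ?thesis by (simp add: Forc_def)
  next
    case 2
    have "x \<in> Forc (segment_on V) \<longleftrightarrow> nb x \<inter> V \<subseteq> {k \<in> V. even k}"
      using 2 Succ_segment_on[OF assms 2] by (simp add: Forc_def)
    also have "\<dots> \<longleftrightarrow> x \<in> V - live V" using 2 unfolding nb_def live_def by force
    finally show ?thesis .
  next
    case 3
    have "x \<in> Forc (segment_on V) \<longleftrightarrow> nb x \<inter> V \<subseteq> {k \<in> V. odd k}"
      using 3 Pred_segment_on[OF assms 3] by (simp add: Forc_def)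
    also have "\<dots> \<longleftrightarrow> x \<in> V - live V" using 3 unfolding nb_def live_def by force
    finally show ?thesis .
  qed
qed

lemma live_live [simp]: "live (live V) = live V"
  by (auto simp: live_def)

lemma relevant_segment_on: "finite V \<Longrightarrow> live V = V \<Longrightarrow> relevant (segment_on V)"
  by (simp add: relevant_def is_position_segment_on Forc_segment_on)

lemma Rmv_segment_on:
  assumes "finite V" "x \<in> V"
  shows "Rmv (segment_on V) x = (nb x \<inter> V) \<union> ((V - nb x) - live (V - nb x))"
    and "move (segment_on V) x = segment_on (live (V - nb x))"
proof -
  have V: "V - nb x \<inter> V = V - nb x" by auto
  show *: "Rmv (segment_on V) x = (nb x \<inter> V) \<union> ((V - nb x) - live (V - nb x))"
    using assms V
    by (auto simp: Rmv_def Succ_segment_on Pred_segment_on remove_segment_on Forc_segment_on)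
  have "V - ((nb x \<inter> V) \<union> ((V - nb x) - live (V - nb x))) = live (V - nb x)"
    by (auto simp: live_def)
  then show "move (segment_on V) x = segment_on (live (V - nb x))"
    by (simp add: move_def * remove_segment_on)
qed

text \<open>A vertex isolated by the move at \<open>x\<close> has lost a neighbour next to
  \<open>x\<close>, so it lies at distance 2 from \<open>x\<close> and belongs to the mover. Hence
  handing it over at once agrees with counting it for its owner at the end.\<close>

lemma sval_move:
  assumes "finite V" "live V = V" "x \<in> V"
  shows "int (card (Rmv (segment_on V) x)) - sval (odd x) (live (V - nb x))
    = int (card (nb x \<inter> V)) - sval (odd x) (V - nb x)"
proof -
  let ?W = "V - nb x" and ?I = "(V - nb x) - live (V - nb x)"
  have par: "even v = even x" if "v \<in> ?I" for v
  proof -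
    have "v \<in> live V" using that assms(2) by simp
    then obtain u where "u \<in> V" "u = v - 1 \<or> u = v + 1" by (auto simp: live_def)
    moreover from this have "u \<in> nb x" using that by (auto simp: live_def)
    ultimately show ?thesis using that by (auto simp: nb_def)
  qed
  have "sval (odd x) ?W = - int (card ?I) + sval (odd x) (?W - ?I)"
    using sval_isolated_set[of ?W ?I "even x" "odd x"] par assms by auto
  moreover have "?W - ?I = live ?W" by (auto simp: live_def)
  moreover have "card ((nb x \<inter> V) \<union> ?I) = card (nb x \<inter> V) + card ?I"
    using assms by (intro card_Un_disjoint) auto
  ultimately show ?thesis using assms by (simp add: Rmv_segment_on)
qed

lemma sval_Max:
  assumes "finite V" "live V \<noteq> {}"
  shows "sval p V = (MAX x\<in>movable p V. int (card (nb x \<inter> V)) - sval (\<not> p) (V - nb x))"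
  using assms by (subst sval.simps) (simp add: movable_empty_iff)

text \<open>Having no isolated vertex makes the position relevant and is restored after each move by
  \<open>live\<close>. The sign for Right arises because \<open>Rs\<close> is Left's score minus
  Right's while \<open>sval\<close> is taken from the mover's side.\<close>

lemma scores_segment_on:
  assumes "finite V" "live V = V"
  shows "Ls (segment_on V) = sval True V" "Rs (segment_on V) = - sval False V"
proof -
  have "Ls (segment_on V) = sval True V \<and> Rs (segment_on V) = - sval False V"
    using assms
  proof (induction "card V" arbitrary: V rule: less_induct)
    case less
    have rel: "relevant (segment_on V)" using less.prems by (rule relevant_segment_on)
    show ?case
    proof (cases "V = {}")
      case True
      then show ?thesis by (simp add: Ls.simps Rs.simps sval_terminal score_def live_def)
    next
      case False
      have IH: "Ls (segment_on (live (V - nb x))) = sval True (live (V - nb x))"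
        "Rs (segment_on (live (V - nb x))) = - sval False (live (V - nb x))" if "x \<in> V" for x
      proof -
        have "live (V - nb x) \<subseteq> V - {x}" by (auto simp: live_def)
        then have "live (V - nb x) \<subset> V" using that by blast
        then have "card (live (V - nb x)) < card V" "finite (live (V - nb x))"
          using less.prems by (auto simp: psubset_card_mono finite_subset)
        then show "Ls (segment_on (live (V - nb x))) = sval True (live (V - nb x))"
          "Rs (segment_on (live (V - nb x))) = - sval False (live (V - nb x))"
          using less.hyps[of "live (V - nb x)"] by auto
      qed
      have mv: "{k \<in> V. even k} = movable True V" "{k \<in> V. odd k} = movable False V"
        using less.prems by (auto simp: movable_def)
      have "Ls (segment_on V) = sval True V"
      proof -
        have "Ls (segment_on V) = (MAX x\<in>movable True V.
            int (card (Rmv (segment_on V) x)) + Rs (move (segment_on V) x))"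
          using rel False mv by (subst Ls.simps) simp
        also have "\<dots> = (MAX x\<in>movable True V.
            int (card (nb x \<inter> V)) - sval (\<not> True) (V - nb x))"
        proof (intro arg_cong[of _ _ Max] image_cong refl)
          fix x assume "x \<in> movable True V"
          then have "x \<in> V" "even x" using mv by auto
          then show "int (card (Rmv (segment_on V) x)) + Rs (move (segment_on V) x)
              = int (card (nb x \<inter> V)) - sval (\<not> True) (V - nb x)"
            using sval_move[OF less.prems, of x] IH[of x] less.prems
            by (simp add: Rmv_segment_on(2))
        qed
        also have "\<dots> = sval True V" using sval_Max[of V True] less.prems False by simp
        finally show ?thesis .
      qed
      moreover have "Rs (segment_on V) = - sval False V"
      proof -
        have "Rs (segment_on V) = (MIN x\<in>movable False V.
            - int (card (Rmv (segment_on V) x)) + Ls (move (segment_on V) x))"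
          using rel False mv by (subst Rs.simps) simp
        also have "\<dots> = (MIN x\<in>movable False V.
            - (int (card (nb x \<inter> V)) - sval (\<not> False) (V - nb x)))"
        proof (intro arg_cong[of _ _ Min] image_cong refl)
          fix x assume "x \<in> movable False V"
          then have "x \<in> V" "odd x" using mv by auto
          then show "- int (card (Rmv (segment_on V) x)) + Ls (move (segment_on V) x)
              = - (int (card (nb x \<inter> V)) - sval (\<not> False) (V - nb x))"
            using sval_move[OF less.prems, of x] IH[of x] less.prems
            by (simp add: Rmv_segment_on(2))
        qed
        also have "\<dots> = - (MAX x\<in>movable False V.
            int (card (nb x \<inter> V)) - sval (\<not> False) (V - nb x))"
          using less.prems False movable_empty_iff[of False V]
          by (subst minus_Max_eq_Min) (auto simp: image_image)
        also have "\<dots> = - sval False V" using sval_Max[of V False] less.prems False by simp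
        finally show ?thesis .
      qed
      ultimately show ?thesis by blast
    qed
  qed
  then show "Ls (segment_on V) = sval True V" "Rs (segment_on V) = - sval False V" by auto
qed

lemma scores_ivl:
  assumes "2 \<le> n"
  shows "Ls (segment_on (ivl a n)) = val True {#comp_of a n#}"
    and "Rs (segment_on (ivl a n)) = - val False {#comp_of a n#}"
proof -
  have "rep (ivl a n) {#comp_of a n#}"
    using rep_add[OF rep_empty, of a n] by (simp add: apart_def)
  moreover have "live (ivl a n) = ivl a n" using assms by (auto simp: live_def ivl_def)
  ultimately show "Ls (segment_on (ivl a n)) = val True {#comp_of a n#}"
    "Rs (segment_on (ivl a n)) = - val False {#comp_of a n#}"
    using scores_segment_on[of "ivl a n"] sval_rep by simp_all
qed

section \<open>Exact sets of values for single segments\<close>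

lemma val_Ev_cases: "0 < n \<Longrightarrow> val p {#Ev n#} \<in> {2, 4}"
  using val_Ev_ge[of n p] val_Ev_le[of p n] even_val[of p "{#Ev n#}"] by simp presburger

lemma val_own_cases: "0 < n \<Longrightarrow> val p {#Od p n#} \<in> {1, 3, 5}"
  using val_own_ge[of n p] val_own_le[of p n] even_val[of p "{#Od p n#}"] by simp presburger

lemma val_opp_cases: "0 < n \<Longrightarrow> val p {#Od (\<not> p) n#} \<in> {1, 3}"
  using val_opp_ge(2)[of n p] val_opp_le[of p n] even_val[of p "{#Od (\<not> p) n#}"]
  by simp presburger

lemma val_opp_odd: "odd n \<Longrightarrow> val p {#Od (\<not> p) n#} = 3"
  using val_opp_ge(1)[of n p] val_opp_le[of p n] by simp

theorem theorem20:
  fixes G :: "(int, int \<times> int) position"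
  assumes "is_segment G"
  shows "(G \<in> C_eq \<longrightarrow> Ls G \<in> {2, 4} \<and> Rs G \<in> {-2, -4}) \<and>
         (G \<in> C_minus \<longrightarrow> Ls G \<in> {1, 3} \<and> Rs G \<in> {-1, -3, -5} \<and>
            (odd (card (left G)) \<longrightarrow> Ls G = 3)) \<and>
         (G \<in> C_plus \<longrightarrow> Ls G \<in> {1, 3, 5} \<and> Rs G \<in> {-1, -3} \<and>
            (even (card (left G)) \<longrightarrow> Rs G = -3))"
proof -
  obtain a b where "a < b" and G: "G = segment_on {a..b}"
    using assms by (auto simp: is_segment_def)
  define n where "n = nat (b - a + 1)"
  have n: "2 \<le> n" "{a..b} = ivl a n" using \<open>a < b\<close> by (auto simp: n_def ivl_def)
  have card_V: "card (vertices G) = n" using n G by (simp add: ivl_def)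
  have Ls: "Ls G = val True {#comp_of a n#}" and Rs: "Rs G = - val False {#comp_of a n#}"
    using scores_ivl[OF n(1)] G n(2) by simp_all
  have sum: "card (left G) + card (right G) = n"
  proof -
    have "finite (left G)" "finite (right G)" using G n(2) finite_ivl[of a n] by simp_all
    moreover have "left G \<union> right G = ivl a n" "left G \<inter> right G = {}" using G n(2) by auto
    ultimately have "card (left G) + card (right G) = card (ivl a n)"
      using card_Un_disjoint[of "left G" "right G"] by simp
    then show ?thesis by (simp add: ivl_def)
  qed
  have diff: "int (card (left G)) - int (card (right G)) = cscore True (comp_of a n)"
  proof -
    have "score True (ivl a n) = int (card (left G)) - int (card (right G))"
      unfolding score_def using G n(2) by (simp add: sum.If_cases Int_def)
    then show ?thesis by (simp add: score_ivl)
  qed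
  show ?thesis
  proof (cases "even n")
    case True
    then obtain m where m: "n = 2 * m" by (elim evenE)
    have "comp_of a n = Ev m" "0 < m" using m n(1) by (simp_all add: comp_of_def)
    then show ?thesis
      using True val_Ev_cases[of m] Ls Rs card_V by (auto simp: C_minus_def C_plus_def)
  next
    case False
    then obtain m where m: "n = 2 * m + 1" by (elim oddE)
    have c: "comp_of a n = Od (even a) m" "0 < m" using m n(1) by (simp_all add: comp_of_def)
    show ?thesis
    proof (cases "even a")
      case True
      \<comment> \<open>Both ends are Left's, so an even number of Left vertices means an odd
        \<open>m\<close>, the case of \<open>val_opp_odd\<close> with Right to move.\<close>
      then have "card (left G) = m + 1" using diff sum m c by simp
      then show ?thesis
        using False True diff c Ls Rs card_V val_own_cases[of m True] val_opp_cases[of m False] val_opp_odd[of m False]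
        by (auto simp: C_eq_def C_minus_def)
    next
      case aodd: False
      then have "card (left G) = m" using diff sum m c by simp
      then show ?thesis
        using False aodd diff c Ls Rs card_V val_own_cases[of m False] val_opp_cases[of m True] val_opp_odd[of m True]
        by (auto simp: C_eq_def C_plus_def)
    qed
  qed
qed

end
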